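(* For $n\ge1$ let $\mathrm{Cat}_B(n)$ be the number of decompositions of the positive roots of type $B_n$ (equivalently $C_n$) into disjoint unions of inversion sets of elements of the Weyl group, where each inversion set contains a single simple root, and put $\mathrm{Cat}_B(0)=1$. Then for $n\ge1$ $$\mathrm{Cat}_B(n)=\mathrm{Cat}_B(n-1)+2\sum_{k=0}^{n-2}\mathrm{Cat}_A(n-k-1)\,\mathrm{Cat}_B(k),$$ and thus $$\sum_{n\ge0}\mathrm{Cat}_B(n)z^n=\frac1{(1-4z)^{1/2}+z}.$$
   Context: With $\varepsilon_1,\dots,\varepsilon_n$ the standard basis of $\mathbb R^n$: the positive roots are $\Delta_{B_n}^+=\{\varepsilon_i\pm\varepsilon_j\mid1\le i<j\le n\}\sqcup\{\varepsilon_i\mid1\le i\le n\}$ with simple roots $\varepsilon_i-\varepsilon_{i+1}$ ($1\le i\le n-1$) and $\varepsilon_n$; $\Delta_{C_n}^+=\{\varepsilon_i\pm\varepsilon_j\mid 1\le i<j\le n\}\sqcup\{2\varepsilon_i\mid1\le i\le n\}$ with simple roots $\varepsilon_i-\varepsilon_{i+1}$ and $2\varepsilon_n$. The Weyl group $\mathcal W(B_n)\cong\mathcal W(C_n)$ is the group of signed permutations of $\varepsilon_1,\dots,\varepsilon_n$ acting linearly; the inversion set of an element $\alpha$ is the set of positive roots $v$ such that $\alpha(v)$ is not a positive root. Decompositions are counted without regard to the order of the inversion sets, and "contains a single simple root" means exactly one. The number is the same for types $B_n$ and $C_n$. $\mathrm{Cat}_A(n)=\frac{1}{n+1}\binom{2n}{n}$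 is the $n$-th Catalan number (equivalently, the number of unordered decompositions of $\{(i,j)\mid 1\le i<j\le n+1\}$ into exactly $n$ nonempty inversion sets of permutations in $S_{n+1}$). The generating function identity is an identity of formal power series. *)

theory Defs
  imports
    "HOL-Library.Function_Algebras"
    "HOL-Library.Disjoint_Sets"
    "HOL-Combinatorics.Permutations"
    "HOL-Computational_Algebra.Formal_Power_Series"
begin

text \<open>
  Since the rank \<open>n\<close> varies within the statement, a vector of \<open>\<real>\<^sup>n\<close> is represented by a function
  \<^typ>\<open>nat \<Rightarrow> real\<close> vanishing outside \<open>{1..n}\<close>; addition and subtraction are pointwise.
\<close>

definition eps :: "nat \<Rightarrow> (nat \<Rightarrow> real)" where
  "eps i = (\<lambda>k. if k = i then 1 else 0)"

definition pos_roots_B :: "nat \<Rightarrow> (nat \<Rightarrow> real) set" where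
  "pos_roots_B n =
     {eps i - eps j | i j. 1 \<le> i \<and> i < j \<and> j \<le> n} \<union>
     {eps i + eps j | i j. 1 \<le> i \<and> i < j \<and> j \<le> n} \<union>
     {eps i | i. 1 \<le> i \<and> i \<le> n}"

definition simple_roots_B :: "nat \<Rightarrow> (nat \<Rightarrow> real) set" where
  "simple_roots_B n = {eps i - eps (i + 1) | i. 1 \<le> i \<and> i < n} \<union> {eps n}"

definition pos_roots_C :: "nat \<Rightarrow> (nat \<Rightarrow> real) set" where
  "pos_roots_C n =
     {eps i - eps j | i j. 1 \<le> i \<and> i < j \<and> j \<le> n} \<union>
     {eps i + eps j | i j. 1 \<le> i \<and> i < j \<and> j \<le> n} \<union>
     {(\<lambda>k. 2 * eps i k) | i. 1 \<le> i \<and> i \<le> n}"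

definition simple_roots_C :: "nat \<Rightarrow> (nat \<Rightarrow> real) set" where
  "simple_roots_C n = {eps i - eps (i + 1) | i. 1 \<le> i \<and> i < n} \<union> {(\<lambda>k. 2 * eps n k)}"

text \<open>The linear map sending \<open>eps i\<close> to \<open>s i * eps (\<sigma> i)\<close> for \<open>i \<in> {1..n}\<close>.\<close>

definition signed_perm_map ::
    "nat \<Rightarrow> (nat \<Rightarrow> nat) \<Rightarrow> (nat \<Rightarrow> real) \<Rightarrow> (nat \<Rightarrow> real) \<Rightarrow> (nat \<Rightarrow> real)" where
  "signed_perm_map n \<sigma> s v = (\<lambda>k. \<Sum>i\<in>{1..n}. v i * (s i * eps (\<sigma> i) k))"

definition weyl_group_BC :: "nat \<Rightarrow> ((nat \<Rightarrow> real) \<Rightarrow> (nat \<Rightarrow> real)) set" where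
  "weyl_group_BC n =
     {signed_perm_map n \<sigma> s | \<sigma> s. \<sigma> permutes {1..n} \<and> (\<forall>i\<in>{1..n}. s i = 1 \<or> s i = -1)}"

definition inversion_set :: "'v set \<Rightarrow> ('v \<Rightarrow> 'v) \<Rightarrow> 'v set" where
  "inversion_set P \<alpha> = {v \<in> P. \<alpha> v \<notin> P}"

text \<open>
  Decompositions are sets of inversion sets, hence unordered. The nonemptiness of the parts built
  into \<^const>\<open>partition_on\<close> is no restriction, as every part contains a simple root.
\<close>

definition decompositions ::
    "('v \<Rightarrow> 'v) set \<Rightarrow> 'v set \<Rightarrow> 'v set \<Rightarrow> 'v set set set" where
  "decompositions W P S =
     {D. partition_on P D \<and> (\<forall>I\<in>D. (\<exists>\<alpha>\<in>W. I = inversion_set P \<alpha>) \<and> (\<exists>!r. r \<in> S \<and> r \<in> I))}"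

definition decompositions_B :: "nat \<Rightarrow> (nat \<Rightarrow> real) set set set" where
  "decompositions_B n = decompositions (weyl_group_BC n) (pos_roots_B n) (simple_roots_B n)"

definition decompositions_C :: "nat \<Rightarrow> (nat \<Rightarrow> real) set set set" where
  "decompositions_C n = decompositions (weyl_group_BC n) (pos_roots_C n) (simple_roots_C n)"

definition cat_A :: "nat \<Rightarrow> real" where
  "cat_A n = 1 / (real n + 1) * real ((2 * n) choose n)"

definition cat_B :: "nat \<Rightarrow> nat" where
  "cat_B n = (if n = 0 then 1 else card (decompositions_B n))"

end

theory Submission
  imports Defs
begin

text \<open>
  Positive roots are indexed by pairs \<open>x < y\<close> of nonzero integers in \<open>{-n..n}\<close>, where \<open>(x, y)\<close> and
  \<open>(-y, -x)\<close> denote the same root: a position \<open>p < 0\<close> stands for \<open>\<epsilon>\<close> with index \<open>n + 1 + p\<close>, and \<open>-p\<close> for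
  its negative. Inversion sets are exactly the biclosed sets of pairs, so a decomposition is a colouring
  \<open>f\<close> of the pairs by the simple roots \<open>0..n-1\<close> (\<open>0\<close> being the root \<open>(-1, 1)\<close> and \<open>c\<close> the root \<open>(c, c+1)\<close>) with
  \<open>f (x, z) \<in> {f (x, y), f (y, z)}\<close> for \<open>x < y < z\<close>, in which every simple root has its own colour.

  Let \<open>c\<close> be the colour of \<open>(-n, n)\<close> and \<open>d\<close> the colour of \<open>(-n, c)\<close>. Then \<open>d \<le> c\<close>, and \<open>f\<close> is determined by
  \<open>d\<close>, \<open>c\<close> and its restrictions to \<open>{d+1..n}\<close> (type A) and to \<open>{-d..d}\<close> (type C). Here \<open>c\<close> is either \<open>d\<close> or
  the colour of \<open>(d+1, n)\<close>, whence the factor \<open>2\<close> unless \<open>d = n - 1\<close>. In type A the colour of the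
  longest pair splits a colouring into two, which is Catalan's recurrence.
\<close>

section \<open>Colourings of pairs\<close>

text \<open>The half-open bounds let a split at colour \<open>c\<close> use the intervals from
  \<open>p\<close> to \<open>c\<close> and from \<open>c\<close> to \<open>q\<close>, leaving out
  only the edge \<open>(c, c + 1)\<close>. The value 0 off the pairs makes equality of colourings
  equality of functions.\<close>

definition colorings_A :: "int \<Rightarrow> int \<Rightarrow> (int \<Rightarrow> int \<Rightarrow> int) set" where
  "colorings_A p q = {g. (\<forall>x y. \<not> (p < x \<and> x < y \<and> y \<le> q) \<longrightarrow> g x y = 0)
     \<and> (\<forall>k. p < k \<and> k < q \<longrightarrow> g k (k + 1) = k)
     \<and> (\<forall>x y z. p < x \<and> x < y \<and> y < z \<and> z \<le> q \<longrightarrow> g x z = g x y \<or> g x z = g y z)}"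

definition pair_C :: "int \<Rightarrow> int \<Rightarrow> int \<Rightarrow> bool" where
  "pair_C n x y \<longleftrightarrow> - n \<le> x \<and> x < y \<and> y \<le> n \<and> x \<noteq> 0 \<and> y \<noteq> 0"

definition colorings_C :: "int \<Rightarrow> (int \<Rightarrow> int \<Rightarrow> int) set" where
  "colorings_C n = {f. (\<forall>x y. \<not> pair_C n x y \<longrightarrow> f x y = 0)
     \<and> (\<forall>x y. f (- y) (- x) = f x y)
     \<and> (0 < n \<longrightarrow> f (- 1) 1 = 0)
     \<and> (\<forall>k. 1 \<le> k \<and> k < n \<longrightarrow> f k (k + 1) = k)
     \<and> (\<forall>x y z. pair_C n x y \<and> pair_C n y z \<longrightarrow> f x z = f x y \<or> f x z = f y z)}"

definition restrict_A :: "int \<Rightarrow> int \<Rightarrow> (int \<Rightarrow> int \<Rightarrow> int) \<Rightarrow> int \<Rightarrow> int \<Rightarrow> int" where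
  "restrict_A p q f = (\<lambda>x y. if p < x \<and> x < y \<and> y \<le> q then f x y else 0)"

definition restrict_C :: "int \<Rightarrow> (int \<Rightarrow> int \<Rightarrow> int) \<Rightarrow> int \<Rightarrow> int \<Rightarrow> int" where
  "restrict_C d f = (\<lambda>x y. if pair_C d x y then f x y else 0)"

section \<open>Type A colourings: splitting at the colour of the longest pair\<close>

lemma colorings_A_range:
  assumes "g \<in> colorings_A p q" "p < x" "x < y" "y \<le> q"
  shows "x \<le> g x y" "g x y < y"
proof -
  \<comment> \<open>Peel off the leftmost edge: the colour of \<open>(x, y)\<close> is
    \<open>x\<close>, the colour of \<open>(x, x + 1)\<close>, or the colour of
    \<open>(x + 1, y)\<close>.\<close>
  have *: "\<forall>x. p < x \<longrightarrow> x < y \<longrightarrow> y - x = int m \<longrightarrow> x \<le> g x y \<and> g x y < y" for m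
  proof (induction m)
    case (Suc m)
    show ?case
    proof (intro allI impI)
      fix x assume x: "p < x" "x < y" "y - x = int (Suc m)"
      have edge: "g x (x + 1) = x"
        using assms x unfolding colorings_A_def by auto
      show "x \<le> g x y \<and> g x y < y"
      proof (cases "x + 1 = y")
        case True
        then show ?thesis using edge x by auto
      next
        case False
        then have "x < x + 1 \<and> x + 1 < y" using x by simp
        then have "g x y = g x (x+1) \<or> g x y = g (x+1) y"
          using assms(1,4) x unfolding colorings_A_def by blast
        moreover have "x + 1 \<le> g (x+1) y \<and> g (x+1) y < y"
          using Suc.IH x False by auto
        ultimately show ?thesis using edge x by auto
      qed
    qed
  qed auto
  show "x \<le> g x y" "g x y < y"
    using *[of "nat (y - x)"] assms by auto
qed

lemma colorings_A_tri:
  assumes "g \<in> colorings_A p q" "p < x" "x < y" "y < z" "z \<le> q"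
  shows "g x z = g x y \<or> g x z = g y z"
  using assms unfolding colorings_A_def by auto

lemma colorings_A_edge:
  assumes "g \<in> colorings_A p q" "p < k" "k < q"
  shows "g k (k + 1) = k"
  using assms unfolding colorings_A_def by auto

lemma colorings_A_outside:
  assumes "g \<in> colorings_A p q" "\<not> (p < x \<and> x < y \<and> y \<le> q)"
  shows "g x y = 0"
  using assms unfolding colorings_A_def by auto

text \<open>The longest pair passes its colour \<open>c\<close> on to every pair across the edge
  \<open>(c, c + 1)\<close>: a piece cut off left of \<open>x\<close> has a colour below
  \<open>x\<close>, and a piece cut off right of \<open>y\<close> has a colour at least
  \<open>y\<close>, so neither can carry \<open>c\<close>.\<close>

lemma colorings_A_top:
  assumes g: "g \<in> colorings_A p q" and "p + 1 < q"
    and x: "p < x" "x \<le> g (p + 1) q" and y: "g (p + 1) q < y" "y \<le> q"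
  shows "g x y = g (p + 1) q"
proof -
  have "g x q = g (p + 1) q"
  proof (cases "x = p + 1")
    case False
    then have "g (p + 1) q = g (p + 1) x \<or> g (p + 1) q = g x q"
      using colorings_A_tri[OF g, of "p + 1" x q] x y by auto
    then show ?thesis
      using colorings_A_range(2)[OF g, of "p + 1" x] x y False by auto
  qed auto
  show ?thesis
  proof (cases "y = q")
    case False
    then have "g x q = g x y \<or> g x q = g y q"
      using colorings_A_tri[OF g, of x y q] x y by auto
    then show ?thesis
      using colorings_A_range(1)[OF g, of y q] x y False \<open>g x q = g (p + 1) q\<close> by auto
  qed (use \<open>g x q = g (p + 1) q\<close> in auto)
qed

lemma restrict_A_in_colorings_A:
  assumes "g \<in> colorings_A p q" "p \<le> p'" "q' \<le> q"
  shows "restrict_A p' q' g \<in> colorings_A p' q'"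
  using assms unfolding colorings_A_def restrict_A_def by auto

definition join_A :: "int \<Rightarrow> int \<Rightarrow> int \<times> (int \<Rightarrow> int \<Rightarrow> int) \<times> (int \<Rightarrow> int \<Rightarrow> int) \<Rightarrow> int \<Rightarrow> int \<Rightarrow> int" where
  "join_A p q = (\<lambda>(c, a, b) x y. if x \<le> c \<and> c < y \<and> p < x \<and> y \<le> q then c
     else if y \<le> c then a x y else b x y)"

lemma join_A_in_colorings_A:
  assumes c: "p < c" "c < q" and a: "a \<in> colorings_A p c" and b: "b \<in> colorings_A c q"
  shows "join_A p q (c, a, b) \<in> colorings_A p q"
proof -
  have "join_A p q (c, a, b) x y = 0" if "\<not> (p < x \<and> x < y \<and> y \<le> q)" for x y
    using that c colorings_A_outside[OF a, of x y] colorings_A_outside[OF b, of x y]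
    by (auto simp: join_A_def)
  moreover have "join_A p q (c, a, b) k (k + 1) = k" if "p < k" "k < q" for k
    using that c colorings_A_edge[OF a, of k] colorings_A_edge[OF b, of k]
    by (auto simp: join_A_def)
  moreover have "join_A p q (c, a, b) x z = join_A p q (c, a, b) x y
      \<or> join_A p q (c, a, b) x z = join_A p q (c, a, b) y z"
    if "p < x" "x < y" "y < z" "z \<le> q" for x y z
    using that c colorings_A_tri[OF a, of x y z] colorings_A_tri[OF b, of x y z]
    by (auto simp: join_A_def)
  ultimately show ?thesis unfolding colorings_A_def by blast
qed

text \<open>The inverse reads \<open>c\<close> off the longest pair and restricts to both sides.
  Nothing is lost, since by \<open>colorings_A_top\<close> all pairs across the split have colour
  \<open>c\<close>.\<close>

lemma bij_betw_join_A:
  assumes "p + 1 < q"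
  shows "bij_betw (join_A p q) (SIGMA c:{p<..<q}. colorings_A p c \<times> colorings_A c q) (colorings_A p q)"
proof (rule bij_betw_byWitness[where
    f' = "\<lambda>g. (g (p + 1) q, restrict_A p (g (p + 1) q) g, restrict_A (g (p + 1) q) q g)"])
  show "\<forall>t\<in>SIGMA c:{p<..<q}. colorings_A p c \<times> colorings_A c q.
      (join_A p q t (p + 1) q, restrict_A p (join_A p q t (p + 1) q) (join_A p q t),
       restrict_A (join_A p q t (p + 1) q) q (join_A p q t)) = t"
  proof
    fix t assume "t \<in> (SIGMA c:{p<..<q}. colorings_A p c \<times> colorings_A c q)"
    then obtain c a b where t: "t = (c, a, b)" and c: "c \<in> {p<..<q}"
      and a: "a \<in> colorings_A p c" and b: "b \<in> colorings_A c q" by blast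
    have 1: "join_A p q (c, a, b) (p + 1) q = c" using c by (auto simp: join_A_def)
    have 2: "restrict_A p c (join_A p q (c, a, b)) = a"
      using c colorings_A_outside[OF a] by (intro ext) (auto simp: join_A_def restrict_A_def)
    have 3: "restrict_A c q (join_A p q (c, a, b)) = b"
      using c colorings_A_outside[OF b] by (intro ext) (auto simp: join_A_def restrict_A_def)
    show "(join_A p q t (p + 1) q, restrict_A p (join_A p q t (p + 1) q) (join_A p q t),
       restrict_A (join_A p q t (p + 1) q) q (join_A p q t)) = t"
      unfolding t 1 2 3 by (rule refl)
  qed
  show "\<forall>g\<in>colorings_A p q. join_A p q
      (g (p + 1) q, restrict_A p (g (p + 1) q) g, restrict_A (g (p + 1) q) q g) = g"
  proof
    fix g assume g: "g \<in> colorings_A p q"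
    show "join_A p q (g (p + 1) q, restrict_A p (g (p + 1) q) g, restrict_A (g (p + 1) q) q g) = g"
    proof (intro ext)
      fix x y
      show "join_A p q (g (p + 1) q, restrict_A p (g (p + 1) q) g, restrict_A (g (p + 1) q) q g) x y = g x y"
        using colorings_A_top[OF g assms, of x y] colorings_A_outside[OF g, of x y]
          colorings_A_range[OF g, of "p+1" q] assms
        by (simp add: join_A_def restrict_A_def not_le not_less)
    qed
  qed
  show "join_A p q ` (SIGMA c:{p<..<q}. colorings_A p c \<times> colorings_A c q) \<subseteq> colorings_A p q"
    using join_A_in_colorings_A by force
  show "(\<lambda>g. (g (p + 1) q, restrict_A p (g (p + 1) q) g, restrict_A (g (p + 1) q) q g)) `
      colorings_A p q \<subseteq> (SIGMA c:{p<..<q}. colorings_A p c \<times> colorings_A c q)"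
    using colorings_A_range[of _ p q "p + 1" q] assms
    by (force intro!: restrict_A_in_colorings_A)
qed

lemma colorings_A_singleton: "colorings_A p (p + 1) = {\<lambda>x y. 0}"
proof -
  have "\<not> (p < x \<and> x < y \<and> y \<le> p + 1)" for x y by linarith
  then show ?thesis unfolding colorings_A_def by (auto simp: fun_eq_iff)
qed

section \<open>Type C colourings: basic properties and the range of colours\<close>

lemma colorings_C_zero: "colorings_C 0 = {\<lambda>x y. 0}"
  unfolding colorings_C_def pair_C_def by auto 

lemma colorings_C_outside:
  assumes "f \<in> colorings_C n" "\<not> pair_C n x y"
  shows "f x y = 0"
  using assms unfolding colorings_C_def by auto

lemma colorings_C_sym:
  assumes "f \<in> colorings_C n"
  shows "f (- y) (- x) = f x y"
  using assms unfolding colorings_C_def by auto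

lemma colorings_C_tri:
  assumes "f \<in> colorings_C n" "- n \<le> x" "x < y" "y < z" "z \<le> n" "x \<noteq> 0" "y \<noteq> 0" "z \<noteq> 0"
  shows "f x z = f x y \<or> f x z = f y z"
  using assms unfolding colorings_C_def pair_C_def by auto

lemma colorings_C_edge:
  assumes "f \<in> colorings_C n" "1 \<le> k" "k < n"
  shows "f k (k + 1) = k"
  using assms unfolding colorings_C_def by auto

lemma colorings_C_central_edge:
  assumes "f \<in> colorings_C n" "0 < n"
  shows "f (- 1) 1 = 0"
  using assms unfolding colorings_C_def by auto

text \<open>Colour \<open>c > 0\<close> names the edge \<open>(c, c + 1)\<close> and its mirror
  \<open>(- c - 1, - c)\<close>; the two alternatives say which of them lies within
  \<open>(x, y)\<close>. For \<open>c = 0\<close> both say that the pair encloses 0. The proof peels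
  off the leftmost edge as in type A.\<close>

lemma colorings_C_range:
  assumes f: "f \<in> colorings_C n" and "pair_C n x y"
  shows "0 \<le> f x y \<and> f x y < n \<and> (x \<le> f x y \<and> f x y < y \<or> x < - f x y \<and> - f x y \<le> y)"
proof -
  \<comment> \<open>An inequality with \<open>int m\<close> is needed in the induction, because
    stepping over the missing position 0 shortens the pair by 2.\<close>
  have "\<forall>x. pair_C n x y \<longrightarrow> y - x \<le> int m \<longrightarrow>
      0 \<le> f x y \<and> f x y < n \<and> (x \<le> f x y \<and> f x y < y \<or> x < - f x y \<and> - f x y \<le> y)" for m
  proof (induction m)
    case (Suc m)
    show ?case
    proof (intro allI impI)
      fix x assume x: "pair_C n x y" "y - x \<le> int (Suc m)"
      define x' where "x' = (if x = -1 then 1 else x + 1)"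
      have edge: "f x x' = (if x < 0 then - x - 1 else x)"
        using colorings_C_edge[OF f, of x] colorings_C_edge[OF f, of "- x - 1"]
          colorings_C_sym[OF f, of "x + 1" x] colorings_C_central_edge[OF f] x
        unfolding x'_def pair_C_def by (auto simp: minus_add_distrib)
      show "0 \<le> f x y \<and> f x y < n \<and> (x \<le> f x y \<and> f x y < y \<or> x < - f x y \<and> - f x y \<le> y)"
      proof (cases "x' = y")
        case True
        then show ?thesis using edge x unfolding x'_def pair_C_def by (auto split: if_splits)
      next
        case False
        then have x': "pair_C n x' y" "y - x' \<le> int m" "x < x'"
          using x unfolding pair_C_def x'_def by (auto split: if_splits)
        have "f x y = f x x' \<or> f x y = f x' y"
          using colorings_C_tri[OF f, of x x' y] x x' unfolding pair_C_def by auto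
        moreover have "0 \<le> f x' y \<and> f x' y < n
            \<and> (x' \<le> f x' y \<and> f x' y < y \<or> x' < - f x' y \<and> - f x' y \<le> y)"
          using Suc.IH x' by blast
        ultimately show ?thesis
          using edge x x' unfolding pair_C_def x'_def by (auto split: if_splits)
      qed
    qed
  qed (auto simp: pair_C_def)
  from this[of "nat (y - x)"] show ?thesis using assms by (auto simp: pair_C_def)
qed

lemma colorings_C_range_pos:
  assumes f: "f \<in> colorings_C n" and "0 < x" "x < y" "y \<le> n"
  shows "x \<le> f x y" "f x y < y"
  using colorings_C_range[OF f, of x y] assms unfolding pair_C_def by auto

lemma colorings_C_diagonal_less:
  assumes f: "f \<in> colorings_C n" and "0 < x" "x \<le> n"
  shows "0 \<le> f (- x) x" "f (- x) x < x"
  using colorings_C_range[OF f, of "- x" x] assms unfolding pair_C_def by auto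

section \<open>Restricting, joining and splitting type C colourings\<close>

lemma restrict_C_in_colorings_C:
  assumes "f \<in> colorings_C n" "d \<le> n"
  shows "restrict_C d f \<in> colorings_C d"
  using assms unfolding colorings_C_def restrict_C_def pair_C_def by auto

lemma restrict_A_in_colorings_A_of_C:
  assumes "f \<in> colorings_C n" "0 \<le> d"
  shows "restrict_A d n f \<in> colorings_A d n"
  using assms unfolding colorings_C_def colorings_A_def restrict_A_def pair_C_def by auto

text \<open>The colour \<open>c\<close> comes from \<open>(m, a)\<close> or from
  \<open>(- a, m)\<close>. The latter is coloured like \<open>(- a, - m)\<close>, the mirror of
  \<open>(m, a)\<close>, or like \<open>(- m, m)\<close>, whose colour is below
  \<open>m \<le> c\<close>.\<close>

lemma colorings_C_pos_of_diagonal: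
  assumes f: "f \<in> colorings_C n" and "0 < m" "m \<le> c" "c < a" "a \<le> n" "f (- a) a = c"
  shows "f m a = c"
proof -
  have "c = f (- a) m \<or> c = f m a" using colorings_C_tri[OF f, of "- a" m a] assms by auto
  moreover have "f (- a) m = f (- a) (- m) \<or> f (- a) m = f (- m) m"
    using colorings_C_tri[OF f, of "- a" "- m" m] assms by auto
  ultimately show ?thesis
    using colorings_C_sym[OF f, of a m] colorings_C_diagonal_less[OF f, of m] assms by auto
qed

text \<open>A split consists of \<open>d\<close>, the type A colouring, \<open>c\<close>, and the inner type C colouring.\<close>

definition join_C :: "int \<Rightarrow> int \<times> (int \<Rightarrow> int \<Rightarrow> int) \<times> int \<times> (int \<Rightarrow> int \<Rightarrow> int) \<Rightarrow> int \<Rightarrow> int \<Rightarrow> int" where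
  "join_C n = (\<lambda>(d, g, c, h) x y.
     if \<not> pair_C n x y then 0
     else if \<bar>x\<bar> \<le> d \<and> \<bar>y\<bar> \<le> d then h x y
     else if d < x then g x y
     else if y < - d then g (- y) (- x)
     else if (\<bar>x\<bar> \<le> d \<or> c < \<bar>x\<bar>) \<and> (\<bar>y\<bar> \<le> d \<or> c < \<bar>y\<bar>) then c else d)"

text \<open>If \<open>c = 0\<close> then \<open>c\<close> is not a position, and \<open>d = 0\<close>.\<close>

definition inner_radius :: "int \<Rightarrow> (int \<Rightarrow> int \<Rightarrow> int) \<Rightarrow> int" where
  "inner_radius n f = (if f (- n) n = 0 then 0 else f (- n) (f (- n) n))"

definition split_C :: "int \<Rightarrow> (int \<Rightarrow> int \<Rightarrow> int) \<Rightarrow> int \<times> (int \<Rightarrow> int \<Rightarrow> int) \<times> int \<times> (int \<Rightarrow> int \<Rightarrow> int)" where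
  "split_C n f = (inner_radius n f, restrict_A (inner_radius n f) n f, f (- n) n, restrict_C (inner_radius n f) f)"

text \<open>The third component is the colour of \<open>(- n, n)\<close>. For
  \<open>d + 1 = n\<close> there is no pair \<open>(d + 1, n)\<close>, and only the value
  \<open>d\<close> remains.\<close>

definition split_data_C :: "int \<Rightarrow> (int \<times> (int \<Rightarrow> int \<Rightarrow> int) \<times> int \<times> (int \<Rightarrow> int \<Rightarrow> int)) set" where
  "split_data_C n = (SIGMA d:{0..<n}. SIGMA g:colorings_A d n.
     (if d + 1 < n then {d, g (d + 1) n} else {d}) \<times> colorings_C d)"

text \<open>Cutting at \<open>- c\<close>, \<open>- d\<close>, \<open>d\<close> and \<open>c\<close>
  gives five blocks, and the colour of a pair in two different blocks depends on the blocks only.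
  The triangle condition thus follows from \<open>g\<close> or \<open>h\<close> inside one block, is
  immediate if two neighbours share a block, and is a finite check for three blocks.\<close>

lemma join_C_in_colorings_C:
  assumes d: "0 \<le> d" "d < n" and g: "g \<in> colorings_A d n" and h: "h \<in> colorings_C d"
    and c: "c = d \<or> d + 1 < n \<and> c = g (d + 1) n"
  shows "join_C n (d, g, c, h) \<in> colorings_C n"
proof -
  let ?f = "join_C n (d, g, c, h)"
  have cn: "d \<le> c" "c < n"
    using c d colorings_A_range[OF g, of "d + 1" n] by auto
  have gc: "g x y = c" if "d < x" "x \<le> c" "c < y" "y \<le> n" for x y
    using colorings_A_top[OF g, of x y] that c d by auto
  have "?f x y = 0" if "\<not> pair_C n x y" for x y
    using that by (simp add: join_C_def)
  moreover have "?f (- y) (- x) = ?f x y" for x y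
    using colorings_C_sym[OF h, of y x] d by (auto simp: join_C_def pair_C_def)
  moreover have "?f (- 1) 1 = 0" if "0 < n"
    using colorings_C_central_edge[OF h] that d cn by (auto simp: join_C_def pair_C_def)
  moreover have "?f k (k + 1) = k" if "1 \<le> k" "k < n" for k
    using colorings_C_edge[OF h, of k] colorings_A_edge[OF g, of k] that d cn
    by (auto simp: join_C_def pair_C_def)
  moreover have "?f x z = ?f x y \<or> ?f x z = ?f y z" if xy: "pair_C n x y" and yz: "pair_C n y z" for x y z
  proof -
    \<comment> \<open>Blocks \<open>- 1\<close> and \<open>1\<close> form the ring of positions
      between \<open>d\<close> and \<open>c\<close> in absolute value, which is empty for
      \<open>c = d\<close>.\<close>
    define block :: "int \<Rightarrow> int" where
      "block v = (if v < - c then - 2 else if v < - d then - 1 else if v \<le> d then 0 else if v \<le> c then 1 else 2)" for v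
    define color :: "int \<Rightarrow> int \<Rightarrow> int" where
      "color i j = (if i + 1 = j \<and> i \<noteq> - 1 \<and> j \<noteq> 1 \<or> i \<in> {- 2, 0, 2} \<and> j \<in> {- 2, 0, 2} then c else d)" for i j
    have block_range: "block v \<in> {- 2, - 1, 0, 1, 2}" for v
      unfolding block_def by auto
    have block_mono: "block v \<le> block w" if "v \<le> w" for v w
      using that cn d unfolding block_def by auto
    have between: "?f v w = color (block v) (block w)" if vw: "pair_C n v w" and "block v \<noteq> block w" for v w
    proof -
      consider "v < - c" "- c \<le> w" "w < - d"
        | "v < - c" "- d \<le> w" "w \<le> d"
        | "v < - c" "d < w" "w \<le> c"
        | "v < - c" "c < w"
        | "- c \<le> v" "v < - d" "- d \<le> w" "w \<le> d"
        | "- c \<le> v" "v < - d" "d < w" "w \<le> c"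
        | "- c \<le> v" "v < - d" "c < w"
        | "- d \<le> v" "v \<le> d" "d < w" "w \<le> c"
        | "- d \<le> v" "v \<le> d" "c < w"
        | "d < v" "v \<le> c" "c < w"
        using vw cn d \<open>block v \<noteq> block w\<close> unfolding block_def pair_C_def by (smt (verit))
      then show ?thesis
        using vw cn d gc[of v w] gc[of "- w" "- v"]
        by cases (simp_all add: join_C_def pair_C_def color_def block_def abs_le_iff)
    qed
    show ?thesis
    proof (cases "block x = block z")
      case True
      then consider "z < - d" | "- d \<le> x" "z \<le> d" | "d < x"
        using cn d unfolding block_def by (smt (verit))
      then show ?thesis
      proof cases
        case 1
        then show ?thesis
          using colorings_A_tri[OF g, of "- z" "- y" "- x"] xy yz d by (auto simp: join_C_def pair_C_def)
      next
        case 2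
        then show ?thesis
          using colorings_C_tri[OF h, of x y z] xy yz d by (auto simp: join_C_def pair_C_def)
      next
        case 3
        then show ?thesis
          using colorings_A_tri[OF g, of x y z] xy yz d by (auto simp: join_C_def pair_C_def)
      qed
    next
      case False
      have xz: "pair_C n x z" using xy yz by (auto simp: pair_C_def)
      consider "block x = block y" | "block y = block z" | "block x < block y" "block y < block z"
        using block_mono[of x y] block_mono[of y z] xy yz by (force simp: pair_C_def)
      then show ?thesis
      proof cases
        case 3
        have "\<forall>i\<in>{- 2, - 1, 0, 1, 2}. \<forall>j\<in>{- 2, - 1, 0, 1, 2}. \<forall>k\<in>{- 2, - 1, 0, 1, 2}.
            i < j \<and> j < k \<longrightarrow> color i k = color i j \<or> color i k = color j k"
          by (simp add: color_def)
        then have "color (block x) (block z) = color (block x) (block y)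
            \<or> color (block x) (block z) = color (block y) (block z)"
          using block_range[of x] block_range[of y] block_range[of z] 3 by blast
        then show ?thesis using between[OF xz] between[OF xy] between[OF yz] 3 by simp
      qed (use False between[OF xz] between[OF xy] between[OF yz] in simp_all)
    qed
  qed
  ultimately show ?thesis unfolding colorings_C_def by blast
qed

lemma split_C_join_C:
  assumes d: "0 \<le> d" "d < n" and g: "g \<in> colorings_A d n" and h: "h \<in> colorings_C d"
    and c: "c = d \<or> d + 1 < n \<and> c = g (d + 1) n"
  shows "split_C n (join_C n (d, g, c, h)) = (d, g, c, h)"
proof -
  have cn: "d \<le> c" "c < n"
    using c d colorings_A_range[OF g, of "d + 1" n] by auto
  have top: "join_C n (d, g, c, h) (- n) n = c"
    using d cn by (auto simp: join_C_def pair_C_def)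
  \<comment> \<open>For \<open>c > d\<close> the position \<open>c\<close> lies in the ring, so
    \<open>(- n, c)\<close> has colour \<open>d\<close>; for \<open>c = d > 0\<close> it has colour
    \<open>c\<close>, which is again \<open>d\<close>; for \<open>c = 0\<close> the default gives
    0.\<close>
  have rad: "inner_radius n (join_C n (d, g, c, h)) = d"
    using d cn by (auto simp: inner_radius_def top) (auto simp: join_C_def pair_C_def)
  have "restrict_A d n (join_C n (d, g, c, h)) = g"
    using d colorings_A_outside[OF g] by (intro ext) (auto simp: restrict_A_def join_C_def pair_C_def)
  moreover have "restrict_C d (join_C n (d, g, c, h)) = h"
    using d colorings_C_outside[OF h] by (intro ext) (auto simp: restrict_C_def join_C_def pair_C_def)
  ultimately show ?thesis unfolding split_C_def rad top by simp
qed

text \<open>Both claims need the same analysis: \<open>c\<close> and \<open>d\<close> force the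
  colour of every pair that is neither inside \<open>{- d..d}\<close> nor entirely on one side of
  it. The main device is to shrink a pair of known colour and to exclude the piece cut off by the
  range of its colours.\<close>

lemma
  assumes f: "f \<in> colorings_C n" and n: "1 \<le> n"
  shows split_C_in_split_data_C: "split_C n f \<in> split_data_C n"
    and join_C_split_C: "join_C n (split_C n f) = f"
proof -
  define c where "c = f (- n) n"
  define d where "d = inner_radius n f"
  have c: "0 \<le> c" "c < n" using colorings_C_diagonal_less[OF f, of n] n by (auto simp: c_def)
  have d_eq: "d = (if c = 0 then 0 else f (- n) c)" by (simp add: d_def c_def inner_radius_def)
  note sym = colorings_C_sym[OF f]
  note tri = colorings_C_tri[OF f]
  note pos = colorings_C_range_pos[OF f]
  note diag = colorings_C_diagonal_less[OF f]
  \<comment> \<open>Shrink \<open>(- n, n)\<close>: the pieces cut off are the mirror of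
    \<open>(a, n)\<close> and the pair \<open>(b, n)\<close>, whose colours exceed
    \<open>c\<close>.\<close>
  have across: "f (- a) b = c" if "c < a" "a \<le> n" "c < b" "b \<le> n" for a b
  proof -
    have "f (- a) n = c"
    proof (cases "a = n")
      case False
      then have "c = f (- n) (- a) \<or> c = f (- a) n"
        using tri[of "- n" "- a" n] that c by (auto simp: c_def)
      then show ?thesis using sym[of n a] pos[of a n] that c False by auto
    qed (simp add: c_def)
    show ?thesis
    proof (cases "b = n")
      case False
      then have "c = f (- a) b \<or> c = f b n"
        using tri[of "- a" b n] that c \<open>f (- a) n = c\<close> by auto
      then show ?thesis using pos[of b n] that c False by auto
    qed (simp add: \<open>f (- a) n = c\<close>)
  qed
  have outer: "f m a = c" if "0 < m" "m \<le> c" "c < a" "a \<le> n" for m a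
    using colorings_C_pos_of_diagonal[OF f, of m c a] across[of a a] that by auto
  \<comment> \<open>The pair \<open>(- n, c)\<close> is coloured like \<open>(- n, - c)\<close>,
    which has colour \<open>c\<close>, or like \<open>(- c, c)\<close>, whose colour is below
    \<open>c\<close>.\<close>
  have "0 \<le> d \<and> d \<le> c"
  proof (cases "c = 0")
    case False
    then have "d = f (- n) (- c) \<or> d = f (- c) c"
      using tri[of "- n" "- c" c] c d_eq by auto
    moreover have "f (- n) (- c) = c" using sym[of n c] outer[of c n] c False by auto
    ultimately show ?thesis using diag[of c] c False by auto
  qed (simp add: d_eq)
  then have d: "0 \<le> d" "d \<le> c" by auto
  \<comment> \<open>The same shrinking, now from \<open>(- n, c)\<close> with its colour
    \<open>d\<close>.\<close>
  have wide: "f (- a) b = d" if "d < a" "a \<le> n" "d < b" "b \<le> c" for a b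
  proof -
    have "f (- n) c = d" using that d d_eq by auto
    have "f (- a) c = d"
    proof (cases "a = n")
      case False
      then have "d = f (- n) (- a) \<or> d = f (- a) c"
        using tri[of "- n" "- a" c] that c d \<open>f (- n) c = d\<close> by auto
      then show ?thesis using sym[of n a] pos[of a n] that d c False by auto
    qed (simp add: \<open>f (- n) c = d\<close>)
    show ?thesis
    proof (cases "b = c")
      case False
      then have "d = f (- a) b \<or> d = f b c"
        using tri[of "- a" b c] that c d \<open>f (- a) c = d\<close> by auto
      then show ?thesis using pos[of b c] that c d False by auto
    qed (simp add: \<open>f (- a) c = d\<close>)
  qed
  have wide': "f (- b) a = d" if "d < a" "a \<le> n" "d < b" "b \<le> c" for a b
    using wide[of a b] sym[of b "- a"] that by simp
  have inner: "f m b = d" if "0 < m" "m \<le> d" "d < b" "b \<le> c" for m b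
    using colorings_C_pos_of_diagonal[OF f, of m d b] wide[of b b] that c by auto
  \<comment> \<open>Here \<open>d < c\<close>, so the colour \<open>d\<close> of
    \<open>(- b, n)\<close> cannot come from \<open>(m, n)\<close>, which has colour
    \<open>c\<close>.\<close>
  have inner': "f (- b) m = d" if "0 < m" "m \<le> d" "d < b" "b \<le> c" for m b
  proof -
    have "f (- b) n = d" using wide'[of n b] that c by auto
    then have "d = f (- b) m \<or> d = f m n" using tri[of "- b" m n] that c d by auto
    moreover have "f m n = c" using outer[of m n] that c d by auto
    ultimately show ?thesis using that by auto
  qed
  \<comment> \<open>If \<open>d = c\<close>, then \<open>(- a, c)\<close> has colour
    \<open>c\<close>, which \<open>(m, c)\<close> cannot supply. If \<open>d < c\<close>, cutting
    \<open>(- a, m)\<close> at \<open>- m\<close> allows \<open>c\<close> or a colour below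
    \<open>m \<le> d\<close>, and cutting at \<open>- c\<close> allows \<open>c\<close> or
    \<open>d\<close>; only \<open>c\<close> is common.\<close>
  have outer': "f (- a) m = c" if "0 < m" "m \<le> d" "c < a" "a \<le> n" for m a
  proof (cases "d = c")
    case True
    have "f (- n) c = c" using d_eq True that by auto
    then have "c = f (- n) (- a) \<or> f (- a) c = c"
      using tri[of "- n" "- a" c] that c d by (cases "a = n") auto
    then have "f (- a) c = c" using sym[of n a] pos[of a n] that c d \<open>f (- n) c = c\<close> by (cases "a = n") auto
    then have "f (- a) m = c \<or> c = f m c"
      using tri[of "- a" m c] that c d by (cases "m = c") auto
    then show ?thesis using pos[of m c] \<open>f (- a) c = c\<close> that c d by (cases "m = c") auto
  next
    case False
    have "f (- a) m = f (- a) (- m) \<or> f (- a) m = f (- m) m"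
      using tri[of "- a" "- m" m] that c d by auto
    moreover have "f (- a) m = f (- a) (- c) \<or> f (- a) m = f (- c) m"
      using tri[of "- a" "- c" m] that c d False by auto
    moreover have "f (- a) (- c) = c" using sym[of a c] outer[of c a] that c d by auto
    moreover have "f (- a) (- m) = c" using sym[of a m] outer[of m a] that c d by auto
    moreover have "f (- c) m = d" using inner'[of m c] that c d False by auto
    moreover have "f (- m) m < m" using diag[of m] that c d by auto
    ultimately show ?thesis using that by linarith
  qed
  show "split_C n f \<in> split_data_C n"
  proof -
    \<comment> \<open>If \<open>d < c\<close>, the pair \<open>(d + 1, n)\<close> leads from the
      ring to the outside and so has colour \<open>c\<close>.\<close>
    have "c = d \<or> d + 1 < n \<and> c = restrict_A d n f (d + 1) n"
      using d c outer[of "d + 1" n] by (cases "d = c") (auto simp: restrict_A_def)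
    then show ?thesis
      using d c restrict_A_in_colorings_A_of_C[OF f d(1)] restrict_C_in_colorings_C[OF f, of d]
      unfolding split_C_def split_data_C_def d_def[symmetric] c_def[symmetric] by auto
  qed
  show "join_C n (split_C n f) = f"
  proof (intro ext)
    fix x y
    show "join_C n (split_C n f) x y = f x y"
    proof (cases "pair_C n x y")
      case False
      then show ?thesis using colorings_C_outside[OF f] by (auto simp: join_C_def split_C_def)
    next
      case True
      have neg: "f x y = f (- y) (- x)" using sym[of y x] by simp
      have "f x y = (if (\<bar>x\<bar> \<le> d \<or> c < \<bar>x\<bar>) \<and> (\<bar>y\<bar> \<le> d \<or> c < \<bar>y\<bar>) then c else d)"
        if *: "\<not> (\<bar>x\<bar> \<le> d \<and> \<bar>y\<bar> \<le> d)" "x \<le> d" "- d \<le> y"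
      proof -
        consider "x < - d" "d < y" | "x < - d" "0 < y" "y \<le> d" | "x < - d" "y < 0" "- d \<le> y"
          | "0 < x" "x \<le> d" "d < y" | "x < 0" "- d \<le> x" "d < y"
          using * True unfolding pair_C_def by linarith
        then show ?thesis
          using True c d across[of "- x" y] wide[of "- x" y] wide'[of y "- x"]
            outer[of x y] outer[of "- y" "- x"] outer'[of y "- x"] outer'[of "- x" y]
            inner[of x y] inner[of "- y" "- x"] inner'[of y "- x"] inner'[of "- x" y] neg
          unfolding pair_C_def by cases auto
      qed
      then show ?thesis
        using True neg unfolding split_C_def join_C_def d_def[symmetric] c_def[symmetric]
        by (auto simp: restrict_A_def restrict_C_def pair_C_def)
    qed
  qed
qed

lemma bij_betw_join_C:
  assumes "1 \<le> n"
  shows "bij_betw (join_C n) (split_data_C n) (colorings_C n)"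
proof (rule bij_betw_byWitness[where f' = "split_C n"])
  show "\<forall>t\<in>split_data_C n. split_C n (join_C n t) = t"
    unfolding split_data_C_def by (auto intro!: split_C_join_C split: if_splits)
  show "\<forall>f\<in>colorings_C n. join_C n (split_C n f) = f"
    using join_C_split_C assms by blast
  show "join_C n ` split_data_C n \<subseteq> colorings_C n"
    unfolding split_data_C_def by (auto intro!: join_C_in_colorings_C split: if_splits)
  show "split_C n ` colorings_C n \<subseteq> split_data_C n"
    using split_C_in_split_data_C assms by blast
qed

section \<open>Catalan numbers and generating functions\<close>

lemma cat_A_Suc: "(real n + 2) * cat_A (Suc n) = (4 * real n + 2) * cat_A n"
proof -
  have c: "real ((2 * m) choose m) = fact (2 * m) / (fact m * fact m)" for m
    using binomial_fact[of m "2 * m", where ?'a = real] by (simp add: mult_2)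
  have f: "(fact (2 * Suc n) :: real) = (2 * real n + 2) * (2 * real n + 1) * fact (2 * n)"
    by (simp add: algebra_simps)
  have "real ((2 * Suc n) choose Suc n) =
      (2 * real n + 2) * (2 * real n + 1) * fact (2 * n) / ((real n + 1)\<^sup>2 * (fact n * fact n))"
    unfolding c f by (simp add: power2_eq_square add.commute)
  also have "\<dots> = (2 * (2 * real n + 1) / (real n + 1)) * real ((2 * n) choose n)"
  proof -
    have "2 * r * a * f / (r\<^sup>2 * g) = 2 * a / r * (f / g)" if "r \<noteq> 0" for r a f g :: real
      using that by (simp add: power2_eq_square)
    moreover have "2 * real n + 2 = 2 * (real n + 1)" by simp
    ultimately show ?thesis
      unfolding c by (metis of_nat_Suc of_nat_neq_0 add.commute)
  qed
  finally have "cat_A (Suc n) = 1 / (real n + 2) * ((2 * (2 * real n + 1) / (real n + 1)) * real ((2 * n) choose n))"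
    unfolding cat_A_def by (simp only:) (simp add: add.commute)
  then show ?thesis
    unfolding cat_A_def by (simp add: add_eq_0_iff)
qed

definition cat_A_fps :: "real fps" where
  "cat_A_fps = Abs_fps cat_A"

text \<open>The ratio of consecutive Catalan numbers says that \<open>T = 1 - 2zC\<close> solves
  \<open>(1 - 4z) T' = - 2 T\<close>, the differential equation of \<open>(1 - 4z)\<^bsup>1/2\<^esup>\<close>.\<close>

lemma cat_A_fps_square:
  includes fps_syntax
  shows "(1 - 2 * fps_X * cat_A_fps)\<^sup>2 = 1 - 4 * fps_X"
proof -
  define T where "T = 1 - 2 * fps_X * cat_A_fps"
  have T_nth: "T $ n = (case n of 0 \<Rightarrow> 1 | Suc m \<Rightarrow> - 2 * cat_A m)" for n
    unfolding T_def cat_A_fps_def by (cases n) (simp_all add: mult.assoc numeral_fps_const)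
  have ode: "(1 - 4 * fps_X) * fps_deriv T = - 2 * T"
  proof (rule fps_ext)
    fix n
    show "((1 - 4 * fps_X) * fps_deriv T) $ n = (- 2 * T) $ n"
    proof (cases n)
      case 0
      then show ?thesis by (simp add: T_nth left_diff_distrib mult.assoc numeral_fps_const fps_const_neg cat_A_def del: fps_const_neg flip: fps_const_neg)
    next
      case (Suc m)
      then show ?thesis using cat_A_Suc[of m]
        by (simp add: T_nth left_diff_distrib mult.assoc numeral_fps_const algebra_simps)
    qed
  qed
  \<comment> \<open>The square solves \<open>(1 - 4z) U' = - 4 U\<close>. The resulting recurrence
    for its coefficients has the factor \<open>n - 1\<close>, so all coefficients beyond degree 1
    vanish.\<close>
  define U where "U = T\<^sup>2"
  have "(1 - 4 * fps_X) * fps_deriv U = 2 * T * ((1 - 4 * fps_X) * fps_deriv T)"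
    unfolding U_def by (simp add: power2_eq_square algebra_simps)
  also have "\<dots> = - 4 * U"
    unfolding ode U_def by (simp add: power2_eq_square)
  finally have U_ode: "(1 - 4 * fps_X) * fps_deriv U = - 4 * U" .
  have step: "(real n + 1) * U $ Suc n = 4 * (real n - 1) * U $ n" for n
  proof -
    have "((1 - 4 * fps_X) * fps_deriv U) $ n = (- 4 * U) $ n" by (simp only: U_ode)
    then show ?thesis
      by (cases n) (simp_all add: left_diff_distrib mult.assoc numeral_fps_const algebra_simps)
  qed
  have U0: "U $ 0 = 1" unfolding U_def by (simp add: T_nth power2_eq_square)
  have U1: "U $ Suc 0 = - 4" using step[of 0] U0 by simp
  have "U $ Suc (Suc n) = 0" for n
  proof (induction n)
    case 0 then show ?case using step[of 1] by simp
  next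
    case (Suc n) then show ?case using step[of "Suc (Suc n)"] by simp
  qed
  then have "U $ n = (1 - 4 * fps_X) $ n" for n
    using U0 U1 by (cases n rule: nat.exhaust; cases "n - 1") (auto simp: numeral_fps_const fps_X_def)
  then show ?thesis unfolding U_def T_def by (simp add: fps_eq_iff)
qed

text \<open>Expanding the square gives this identity multiplied by \<open>4 * fps_X\<close>, a
  nonzero factor in an integral domain.\<close>

lemma cat_A_fps_eq: "cat_A_fps = 1 + fps_X * cat_A_fps\<^sup>2"
proof -
  have "4 * fps_X * (cat_A_fps - (1 + fps_X * cat_A_fps\<^sup>2)) = 0"
    using cat_A_fps_square by (simp add: power2_eq_square algebra_simps)
  then show ?thesis by auto
qed

lemma cat_A_recurrence:
  includes fps_syntax
  shows "cat_A (Suc n) = (\<Sum>i\<le>n. cat_A i * cat_A (n - i))"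
proof -
  have "(cat_A_fps\<^sup>2) $ n = (\<Sum>i\<le>n. cat_A i * cat_A (n - i))"
    by (simp add: cat_A_fps_def power2_eq_square fps_mult_nth atMost_atLeast0)
  moreover have "cat_A (Suc n) = (1 + fps_X * cat_A_fps\<^sup>2) $ Suc n"
    by (subst cat_A_fps_eq[symmetric]) (simp add: cat_A_fps_def)
  ultimately show ?thesis by simp
qed

text \<open>The radical takes \<open>root 2\<close> of the constant coefficient, which is 1; this
  selects \<open>1 - 2zC\<close> rather than its negative.\<close>

lemma fps_radical_eq: "fps_radical root 2 (1 - 4 * fps_X) = 1 - 2 * fps_X * cat_A_fps"
proof -
  have "fps_radical root 2 ((1 - 2 * fps_X * cat_A_fps)\<^sup>2) = 1 - 2 * fps_X * cat_A_fps"
    using radical_power[of root 1 "1 - 2 * fps_X * cat_A_fps"] by (simp add: numeral_2_eq_2)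
  then show ?thesis by (simp add: cat_A_fps_square)
qed

text \<open>Extending the sum to \<open>k = n - 1\<close>, where \<open>cat_A 0 = 1\<close>, turns
  \<open>+ b (n - 1)\<close> into \<open>- b (n - 1)\<close> and the sum into a convolution. Hence
  \<open>B (1 - 2zC + z) = 1\<close> for the two generating functions.\<close>

lemma fps_of_recurrence:
  includes fps_syntax
  fixes b :: "nat \<Rightarrow> real"
  assumes b0: "b 0 = 1"
    and b: "\<And>n. n \<ge> 1 \<Longrightarrow> b n = b (n - 1) + 2 * (\<Sum>k\<in>{0..<n - 1}. cat_A (n - k - 1) * b k)"
  shows "Abs_fps b = 1 / (fps_radical root 2 (1 - 4 * fps_X) + fps_X)"
proof -
  have b': "b (Suc m) = 2 * (\<Sum>k\<le>m. b k * cat_A (m - k)) - b m" for m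
  proof -
    have "(\<Sum>k\<le>m. b k * cat_A (m - k)) = (\<Sum>k<m. cat_A (m - k) * b k) + b m"
      by (simp add: lessThan_Suc_atMost[symmetric] cat_A_def[of 0] mult.commute)
    then show ?thesis using b[of "Suc m"] by (simp add: atLeast0LessThan)
  qed
  have conv: "(Abs_fps b * cat_A_fps) $ m = (\<Sum>k\<le>m. b k * cat_A (m - k))" for m
    by (simp add: cat_A_fps_def fps_mult_nth atMost_atLeast0)
  have "Abs_fps b = 1 + 2 * (fps_X * (Abs_fps b * cat_A_fps)) - fps_X * Abs_fps b"
  proof (rule fps_ext)
    fix n show "Abs_fps b $ n = (1 + 2 * (fps_X * (Abs_fps b * cat_A_fps)) - fps_X * Abs_fps b) $ n"
      by (cases n) (simp_all add: b0 b' conv numeral_fps_const)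
  qed
  then have "Abs_fps b * (fps_radical root 2 (1 - 4 * fps_X) + fps_X) = 1"
    unfolding fps_radical_eq by (simp add: algebra_simps)
  moreover have "fps_radical root 2 (1 - 4 * fps_X) + fps_X \<noteq> (0 :: real fps)"
    using calculation by auto
  ultimately show ?thesis
    by (metis nonzero_mult_div_cancel_right)
qed

section \<open>Counting colourings\<close>

text \<open>Here \<open>m\<close> is the number of edges of the interval. A split removes one edge
  and leaves \<open>i\<close> and \<open>m - 1 - i\<close> of them, which gives Catalan's
  recurrence.\<close>

lemma card_colorings_A:
  "finite (colorings_A p (p + 1 + int m)) \<and> real (card (colorings_A p (p + 1 + int m))) = cat_A m"
proof (induction m arbitrary: p rule: less_induct)
  case (less m)
  show ?case
  proof (cases m)
    case 0
    then show ?thesis by (simp add: colorings_A_singleton cat_A_def)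
  next
    case (Suc l)
    define q where "q = p + 1 + int m"
    define c where "c i = p + 1 + int i" for i
    have left: "finite (colorings_A p (c i))" "real (card (colorings_A p (c i))) = cat_A i" if "i \<le> l" for i
      using less.IH[of i p] that Suc by (auto simp: c_def)
    have right: "finite (colorings_A (c i) q)" "real (card (colorings_A (c i) q)) = cat_A (l - i)" if "i \<le> l" for i
    proof -
      have "q = c i + 1 + int (l - i)" using that Suc by (simp add: q_def c_def of_nat_diff)
      then show "finite (colorings_A (c i) q)" "real (card (colorings_A (c i) q)) = cat_A (l - i)"
        using less.IH[of "l - i" "c i"] Suc by auto
    qed
    have range_c: "{p<..<q} = c ` {..l}"
    proof
      show "{p<..<q} \<subseteq> c ` {..l}"
      proof
        fix x assume "x \<in> {p<..<q}"
        then have "x = c (nat (x - p - 1))" "nat (x - p - 1) \<le> l" using Suc by (auto simp: q_def c_def)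
        then show "x \<in> c ` {..l}" by blast
      qed
    qed (use Suc in \<open>auto simp: q_def c_def\<close>)
    have bij: "bij_betw (join_A p q) (SIGMA c:{p<..<q}. colorings_A p c \<times> colorings_A c q) (colorings_A p q)"
      by (rule bij_betw_join_A) (simp add: q_def Suc)
    have fin: "\<forall>x\<in>{p<..<q}. finite (colorings_A p x \<times> colorings_A x q)"
      unfolding range_c using left right by auto
    have "finite (SIGMA c:{p<..<q}. colorings_A p c \<times> colorings_A c q)"
      using fin by (intro finite_SigmaI[OF finite_greaterThanLessThan_int]) blast
    then have "finite (colorings_A p q)" using bij bij_betw_finite by blast
    have "card (colorings_A p q) = card (SIGMA c:{p<..<q}. colorings_A p c \<times> colorings_A c q)"
      using bij_betw_same_card[OF bij] by simp
    also have "\<dots> = (\<Sum>x\<in>{p<..<q}. card (colorings_A p x) * card (colorings_A x q))"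
      using card_SigmaI[OF finite_greaterThanLessThan_int fin] by (simp add: card_cartesian_product)
    also have "\<dots> = (\<Sum>i\<le>l. card (colorings_A p (c i)) * card (colorings_A (c i) q))"
      unfolding range_c by (subst sum.reindex) (auto simp: inj_on_def c_def)
    finally have "real (card (colorings_A p q)) = (\<Sum>i\<le>l. cat_A i * cat_A (l - i))"
      using left right by simp
    then show ?thesis
      using \<open>finite (colorings_A p q)\<close> Suc cat_A_recurrence[of l] by (simp add: q_def)
  qed
qed

text \<open>This counts the split data by \<open>d\<close>. The term \<open>d = n - 1\<close> has a
  single choice for \<open>c\<close> and the factor \<open>cat_A 0 = 1\<close>, and becomes the
  separate summand; every other \<open>d\<close> contributes twice.\<close>

lemma
  assumes "1 \<le> n"
    and fin: "\<And>d. d < n \<Longrightarrow> finite (colorings_C (int d))"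
  shows finite_colorings_C_step: "finite (colorings_C (int n))"
    and card_colorings_C_step: "real (card (colorings_C (int n))) =
      real (card (colorings_C (int (n - 1))))
        + 2 * (\<Sum>k\<in>{0..<n - 1}. cat_A (n - k - 1) * real (card (colorings_C (int k))))"
proof -
  define F where "F d g = (if d + 1 < int n then {d, g (d + 1) (int n)} else {d})"
    for d and g :: "int \<Rightarrow> int \<Rightarrow> int"
  \<comment> \<open>The two choices differ because \<open>g (d + 1) n\<close> is at least
    \<open>d + 1\<close>.\<close>
  have card_F: "card (F (int d) g) = (if d + 1 < n then 2 else 1)" if "g \<in> colorings_A (int d) (int n)" for d g
    using colorings_A_range(1)[OF that, of "int d + 1" "int n"] by (auto simp: F_def card_insert_if)
  have A: "finite (colorings_A (int d) (int n))" "real (card (colorings_A (int d) (int n))) = cat_A (n - d - 1)"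
    if "d < n" for d
  proof -
    have "int d + 1 + int (n - d - 1) = int n" using that by simp
    note card_colorings_A[of "int d" "n - d - 1", unfolded this]
    then show "finite (colorings_A (int d) (int n))" "real (card (colorings_A (int d) (int n))) = cat_A (n - d - 1)"
      by blast+
  qed
  have range_d: "{0..<int n} = int ` {..<n}" by (metis image_int_atLeastLessThan lessThan_atLeast0 of_nat_0)
  have data: "split_data_C (int n) = (SIGMA d:{0..<int n}. SIGMA g:colorings_A d (int n). F d g \<times> colorings_C d)"
    unfolding split_data_C_def F_def ..
  have fin1: "finite (SIGMA g:colorings_A d (int n). F d g \<times> colorings_C d)" if "d \<in> {0..<int n}" for d
  proof -
    obtain k where "d = int k" "k < n" using \<open>d \<in> {0..<int n}\<close> unfolding range_d by auto
    then show ?thesis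
      using fin[of k] A(1)[of k] by (intro finite_SigmaI finite_cartesian_product) (auto simp: F_def)
  qed
  have bij: "bij_betw (join_C (int n)) (split_data_C (int n)) (colorings_C (int n))"
    using bij_betw_join_C assms by simp
  have "finite (split_data_C (int n))" unfolding data by (rule finite_SigmaI[OF _ fin1]) auto
  then show "finite (colorings_C (int n))" using bij bij_betw_finite by blast
  have summand: "real (card (SIGMA g:colorings_A (int d) (int n). F (int d) g \<times> colorings_C (int d))) =
      (if d + 1 < n then 2 else 1) * (cat_A (n - d - 1) * real (card (colorings_C (int d))))" if "d < n" for d
  proof -
    have "card (SIGMA g:colorings_A (int d) (int n). F (int d) g \<times> colorings_C (int d)) =
        (\<Sum>g\<in>colorings_A (int d) (int n). (if d + 1 < n then 2 else 1) * card (colorings_C (int d)))"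
      by (subst card_SigmaI) (use A(1)[OF that] fin[OF that] in \<open>simp_all add: card_cartesian_product card_F\<close>,
        simp_all add: F_def)
    then show ?thesis using A(2)[OF that] by simp
  qed
  have "card (colorings_C (int n)) = card (split_data_C (int n))"
    using bij_betw_same_card[OF bij] by simp
  also have "\<dots> = (\<Sum>d\<in>{0..<int n}. card (SIGMA g:colorings_A d (int n). F d g \<times> colorings_C d))"
    unfolding data by (rule card_SigmaI) (use fin1 in auto)
  also have "\<dots> = (\<Sum>d<n. card (SIGMA g:colorings_A (int d) (int n). F (int d) g \<times> colorings_C (int d)))"
    unfolding range_d by (subst sum.reindex) auto
  finally have "real (card (colorings_C (int n))) =
      (\<Sum>d<n. (if d + 1 < n then 2 else 1) * (cat_A (n - d - 1) * real (card (colorings_C (int d)))))"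
    using summand by simp
  also obtain m where n: "n = Suc m" using assms by (cases n) auto
  have "(\<Sum>d<n. (if d + 1 < n then 2 else 1) * (cat_A (n - d - 1) * real (card (colorings_C (int d))))) =
      (\<Sum>d<m. 2 * (cat_A (n - d - 1) * real (card (colorings_C (int d))))) + real (card (colorings_C (int m)))"
    unfolding n by (simp add: cat_A_def[of 0])
  finally show "real (card (colorings_C (int n))) = real (card (colorings_C (int (n - 1))))
        + 2 * (\<Sum>k\<in>{0..<n - 1}. cat_A (n - k - 1) * real (card (colorings_C (int k))))"
    by (simp add: n sum_distrib_left lessThan_atLeast0)
qed

lemma finite_colorings_C: "finite (colorings_C (int n))"
proof (induction n rule: less_induct)
  case (less n)
  then show ?case
    using finite_colorings_C_step[of n] by (cases "n = 0") (auto simp: colorings_C_zero)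
qed

lemmas card_colorings_C = card_colorings_C_step[OF _ finite_colorings_C]

section \<open>Roots and inversion sets\<close>

definition positions :: "nat \<Rightarrow> int set" where
  "positions n = {x. x \<noteq> 0 \<and> \<bar>x\<bar> \<le> int n}"

definition coord :: "nat \<Rightarrow> int \<Rightarrow> nat" where
  "coord n x = nat (int n + 1 - \<bar>x\<bar>)"

text \<open>From position \<open>- n\<close> upwards the vectors are
  \<open>eps 1, ..., eps n, - eps n, ..., - eps 1\<close>, so that an earlier vector minus a later
  one is a positive root up to scaling.\<close>

definition signed_eps :: "nat \<Rightarrow> int \<Rightarrow> nat \<Rightarrow> real" where
  "signed_eps n x = (\<lambda>k. - of_int (sgn x) * eps (coord n x) k)"

text \<open>The scaling \<open>w\<close> of the roots \<open>\<epsilon>\<^sub>i\<close> is \<open>1\<close> in type B and \<open>2\<close> in type C.\<close>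

definition pair_root :: "real \<Rightarrow> nat \<Rightarrow> int \<Rightarrow> int \<Rightarrow> nat \<Rightarrow> real" where
  "pair_root w n x y = (\<lambda>k. (if y = - x then w / 2 else 1) * (signed_eps n x k - signed_eps n y k))"

definition roots :: "real \<Rightarrow> nat \<Rightarrow> (nat \<Rightarrow> real) set" where
  "roots w n = {pair_root w n x y | x y. pair_C (int n) x y}"

text \<open>For \<open>0 < c < n\<close> this is \<open>eps (n - c) - eps (n - c + 1)\<close>, so
  colours run against the usual numbering; colour 0 is \<open>w\<close> times
  \<open>eps n\<close>.\<close>

definition simple_root :: "real \<Rightarrow> nat \<Rightarrow> int \<Rightarrow> nat \<Rightarrow> real" where
  "simple_root w n c = (if c = 0 then pair_root w n (- 1) 1 else pair_root w n c (c + 1))"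

lemma pair_C_iff: "pair_C (int n) x y \<longleftrightarrow> x \<in> positions n \<and> y \<in> positions n \<and> x < y"
  unfolding pair_C_def positions_def by auto

lemma finite_positions: "finite (positions n)"
  by (rule finite_subset[of _ "{- int n..int n}"]) (auto simp: positions_def)

lemma uminus_positions [simp]: "- x \<in> positions n \<longleftrightarrow> x \<in> positions n"
  unfolding positions_def by auto

lemma coord_bounds: "x \<in> positions n \<Longrightarrow> coord n x \<in> {1..n}"
  unfolding positions_def coord_def by auto

lemma coord_uminus [simp]: "coord n (- x) = coord n x"
  unfolding coord_def by simp

lemma signed_eps_uminus: "signed_eps n (- x) k = - signed_eps n x k"
  unfolding signed_eps_def by (simp add: sgn_minus)

lemma pair_root_uminus: "pair_root w n (- y) (- x) = pair_root w n x y"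
  unfolding pair_root_def by (auto simp: signed_eps_uminus fun_eq_iff)

lemma coord_eq_iff:
  assumes "x \<in> positions n" "y \<in> positions n"
  shows "coord n x = coord n y \<longleftrightarrow> x = y \<or> x = - y"
  using assms unfolding coord_def positions_def by auto

text \<open>The quantity tested is the inner product of the root with \<open>signed_eps n z\<close>.
  A root therefore remembers its pair up to the mirror image \<open>(- y, - x)\<close>.\<close>

lemma pair_root_support:
  assumes "0 < w" and x: "x \<in> positions n" and y: "y \<in> positions n" and "x \<noteq> y"
  shows "{z \<in> positions n. 0 < - of_int (sgn z) * pair_root w n x y (coord n z)} = {x, - y}"
proof -
  have val: "- of_int (sgn z) * signed_eps n x (coord n z) = (if z = x then 1 else if z = - x then - 1 else 0)"
    if "z \<in> positions n" "x \<in> positions n" for z x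
    using that coord_eq_iff[OF that]
    by (auto simp: signed_eps_def eps_def positions_def sgn_if)
  have "- of_int (sgn z) * pair_root w n x y (coord n z) = (if y = - x then w / 2 else 1) *
      ((if z = x then 1 else if z = - x then - 1 else 0) - (if z = y then 1 else if z = - y then - 1 else 0))"
    if "z \<in> positions n" for z
    using val[OF that x] val[OF that y] unfolding pair_root_def by (auto simp: algebra_simps)
  note eq = this
  have "0 < - of_int (sgn z) * pair_root w n x y (coord n z) \<longleftrightarrow> z = x \<or> z = - y"
    if "z \<in> positions n" for z
    unfolding eq[OF that] using assms that by (auto simp: positions_def)
  then have "{z \<in> positions n. 0 < - of_int (sgn z) * pair_root w n x y (coord n z)} =
      {z \<in> positions n. z = x \<or> z = - y}" by blast
  also have "\<dots> = {x, - y}" using x y by auto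
  finally show ?thesis .
qed

lemma pair_root_eq_iff:
  assumes "0 < w" "x \<in> positions n" "y \<in> positions n" "x \<noteq> y"
    "x' \<in> positions n" "y' \<in> positions n" "x' \<noteq> y'"
  shows "pair_root w n x y = pair_root w n x' y' \<longleftrightarrow> x' = x \<and> y' = y \<or> x' = - y \<and> y' = - x"
proof
  assume eq: "pair_root w n x y = pair_root w n x' y'"
  have "{x, - y} = {x', - y'}"
    using pair_root_support[OF assms(1-4)] pair_root_support[OF assms(1,5-7)] unfolding eq by simp
  then show "x' = x \<and> y' = y \<or> x' = - y \<and> y' = - x" by (auto simp: doubleton_eq_iff)
qed (auto simp: pair_root_uminus)

lemma pair_root_in_roots_iff:
  assumes "0 < w" "x \<in> positions n" "y \<in> positions n" "x \<noteq> y"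
  shows "pair_root w n x y \<in> roots w n \<longleftrightarrow> x < y"
proof
  assume "pair_root w n x y \<in> roots w n"
  then obtain x' y' where "x' \<in> positions n" "y' \<in> positions n" "x' < y'" "pair_root w n x y = pair_root w n x' y'"
    unfolding roots_def pair_C_iff by auto
  then show "x < y" using pair_root_eq_iff[OF assms, of x' y'] by auto
qed (use assms in \<open>auto simp: roots_def pair_C_iff\<close>)

lemma signed_eps_position: "i \<in> {1..n} \<Longrightarrow> signed_eps n (int i - int n - 1) = eps i"
  by (auto simp: signed_eps_def coord_def)

lemma signed_eps_position': "i \<in> {1..n} \<Longrightarrow> signed_eps n (int n + 1 - int i) = (\<lambda>k. - eps i k)"
  by (auto simp: signed_eps_def coord_def)

text \<open>Pairs on one side of 0 are the differences, the pairs \<open>(x, - x)\<close> the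
  multiples of a basis vector, and the other pairs across 0 the sums.\<close>

lemma roots_cases:
  "roots w n = {eps i - eps j | i j. 1 \<le> i \<and> i < j \<and> j \<le> n} \<union>
     {eps i + eps j | i j. 1 \<le> i \<and> i < j \<and> j \<le> n} \<union>
     {(\<lambda>k. w * eps i k) | i. 1 \<le> i \<and> i \<le> n}" (is "_ = ?A \<union> ?B \<union> ?C")
proof (intro equalityI subsetI)
  fix v assume "v \<in> roots w n"
  then obtain x y where v: "v = pair_root w n x y" and xy: "x \<in> positions n" "y \<in> positions n" "x < y"
    unfolding roots_def pair_C_iff by auto
  have c: "coord n x \<in> {1..n}" "coord n y \<in> {1..n}" using xy coord_bounds by auto
  consider "y < 0" | "0 < x" | "x < 0" "0 < y" "y = - x" | "x < 0" "0 < y" "- x < y" | "x < 0" "0 < y" "y < - x"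
    using xy by (auto simp: positions_def) linarith
  then show "v \<in> ?A \<union> ?B \<union> ?C"
  proof cases
    case 1
    then have "v = eps (coord n x) - eps (coord n y)" "coord n x < coord n y"
      using xy by (auto simp: v pair_root_def signed_eps_def coord_def positions_def)
    then show ?thesis using c by auto
  next
    case 2
    then have "v = eps (coord n y) - eps (coord n x)" "coord n y < coord n x"
      using xy by (auto simp: v pair_root_def signed_eps_def coord_def positions_def)
    then show ?thesis using c by auto
  next
    case 3
    then have "v = (\<lambda>k. w * eps (coord n x) k)"
      using xy by (auto simp: v pair_root_def signed_eps_def)
    then show ?thesis using c by auto
  next
    case 4
    then have "v = eps (coord n y) + eps (coord n x)" "coord n y < coord n x"
      using xy by (auto simp: v pair_root_def signed_eps_def coord_def positions_def)
    then show ?thesis using c by fastforce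
  next
    case 5
    then have "v = eps (coord n x) + eps (coord n y)" "coord n x < coord n y"
      using xy by (auto simp: v pair_root_def signed_eps_def coord_def positions_def)
    then show ?thesis using c by fastforce
  qed
next
  fix v assume "v \<in> ?A \<union> ?B \<union> ?C"
  then consider i j where "v = eps i - eps j" "1 \<le> i" "i < j" "j \<le> n"
    | i j where "v = eps i + eps j" "1 \<le> i" "i < j" "j \<le> n"
    | i where "v = (\<lambda>k. w * eps i k)" "1 \<le> i" "i \<le> n" by blast
  then show "v \<in> roots w n"
  proof cases
    case 1
    then have "v = pair_root w n (int i - int n - 1) (int j - int n - 1)"
      by (auto simp: pair_root_def signed_eps_position)
    moreover have "pair_C (int n) (int i - int n - 1) (int j - int n - 1)"
      using 1 by (auto simp: pair_C_def)
    ultimately show ?thesis unfolding roots_def by blast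
  next
    case 2
    then have "v = pair_root w n (int i - int n - 1) (int n + 1 - int j)"
      by (auto simp: pair_root_def signed_eps_position signed_eps_position')
    moreover have "pair_C (int n) (int i - int n - 1) (int n + 1 - int j)"
      using 2 by (auto simp: pair_C_def)
    ultimately show ?thesis unfolding roots_def by blast
  next
    case 3
    then have "v = pair_root w n (int i - int n - 1) (int n + 1 - int i)"
      by (auto simp: pair_root_def signed_eps_position signed_eps_position')
    moreover have "pair_C (int n) (int i - int n - 1) (int n + 1 - int i)"
      using 3 by (auto simp: pair_C_def)
    ultimately show ?thesis unfolding roots_def by blast
  qed
qed

lemma pos_roots_B_eq: "pos_roots_B n = roots 1 n"
  unfolding pos_roots_B_def roots_cases by simp

lemma pos_roots_C_eq: "pos_roots_C n = roots 2 n"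
  unfolding pos_roots_C_def roots_cases by simp

lemma simple_roots_cases:
  assumes "1 \<le> n"
  shows "simple_root w n ` {0..<int n} = {eps i - eps (i + 1) | i. 1 \<le> i \<and> i < n} \<union> {(\<lambda>k. w * eps n k)}"
proof -
  have 0: "simple_root w n 0 = (\<lambda>k. w * eps n k)"
    using assms by (auto simp: simple_root_def pair_root_def signed_eps_def coord_def)
  have 1: "simple_root w n (int n - int i) = eps i - eps (i + 1)" if "1 \<le> i" "i < n" for i
  proof -
    have "coord n (int n - int i) = i + 1" "coord n (int n - int i + 1) = i"
      using that by (auto simp: coord_def)
    then show ?thesis using that by (auto simp: simple_root_def pair_root_def signed_eps_def)
  qed
  have "{0..<int n} = insert 0 ((\<lambda>i. int n - int i) ` {1..<n})"
  proof (intro equalityI subsetI)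
    fix c assume "c \<in> {0..<int n}"
    then have "c = 0 \<or> c = int n - int (n - nat c) \<and> n - nat c \<in> {1..<n}" by auto
    then show "c \<in> insert 0 ((\<lambda>i. int n - int i) ` {1..<n})" by blast
  qed (use assms in auto)
  then have "simple_root w n ` {0..<int n} =
      insert (simple_root w n 0) ((\<lambda>i. simple_root w n (int n - int i)) ` {1..<n})"
    by (simp add: image_image)
  also have "(\<lambda>i. simple_root w n (int n - int i)) ` {1..<n} = {eps i - eps (i + 1) | i. 1 \<le> i \<and> i < n}"
    using 1 by (auto simp: image_iff)
  finally show ?thesis by (simp add: 0)
qed

lemma simple_roots_B_eq: "1 \<le> n \<Longrightarrow> simple_roots_B n = simple_root 1 n ` {0..<int n}"
  unfolding simple_roots_B_def by (subst simple_roots_cases) auto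

lemma simple_roots_C_eq: "1 \<le> n \<Longrightarrow> simple_roots_C n = simple_root 2 n ` {0..<int n}"
  unfolding simple_roots_C_def by (subst simple_roots_cases) auto

section \<open>Weyl group elements as odd permutations of positions, inversion sets as biclosed
  sets\<close>

lemma signed_perm_map_scaled_diff:
  "signed_perm_map n \<sigma> s (\<lambda>k. a * (v k - w k)) =
     (\<lambda>k. a * (signed_perm_map n \<sigma> s v k - signed_perm_map n \<sigma> s w k))"
  unfolding signed_perm_map_def
  by (simp add: sum_subtractf[symmetric] sum_distrib_left algebra_simps)

lemma signed_perm_map_signed_eps:
  assumes x: "x \<in> positions n" and y: "y \<in> positions n"
    and coord: "coord n y = \<sigma> (coord n x)" and sgn: "of_int (sgn y) = of_int (sgn x) * s (coord n x)"
  shows "signed_perm_map n \<sigma> s (signed_eps n x) = signed_eps n y"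
proof
  fix k
  have "signed_perm_map n \<sigma> s (signed_eps n x) k =
      (\<Sum>i\<in>{1..n}. if coord n x = i then - of_int (sgn x) * (s i * eps (\<sigma> i) k) else 0)"
    unfolding signed_perm_map_def by (intro sum.cong) (auto simp: signed_eps_def eps_def)
  also have "\<dots> = - of_int (sgn x) * (s (coord n x) * eps (\<sigma> (coord n x)) k)"
    using coord_bounds[OF x] by (subst sum.delta') auto
  also have "\<dots> = signed_eps n y k"
    by (simp add: signed_eps_def coord sgn)
  finally show "signed_perm_map n \<sigma> s (signed_eps n x) k = signed_eps n y k" .
qed

lemma signed_perm_map_pair_root:
  assumes "\<And>x. x \<in> positions n \<Longrightarrow> signed_perm_map n \<sigma> s (signed_eps n x) = signed_eps n (\<pi> x)"
    and odd: "\<And>x. x \<in> positions n \<Longrightarrow> \<pi> (- x) = - \<pi> x"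
    and inj: "inj_on \<pi> (positions n)" and "x \<in> positions n" "y \<in> positions n"
  shows "signed_perm_map n \<sigma> s (pair_root w n x y) = pair_root w n (\<pi> x) (\<pi> y)"
proof -
  have "\<pi> y = - \<pi> x \<longleftrightarrow> y = - x"
    using odd[of x] inj assms(4,5) by (metis inj_onD uminus_positions)
  then show ?thesis
    unfolding pair_root_def using assms by (simp add: signed_perm_map_scaled_diff)
qed

lemma weyl_group_BC_position_map:
  assumes "\<alpha> \<in> weyl_group_BC n"
  obtains \<pi> where "\<And>x. x \<in> positions n \<Longrightarrow> \<pi> x \<in> positions n" "inj_on \<pi> (positions n)"
    "\<And>w x y. x \<in> positions n \<Longrightarrow> y \<in> positions n \<Longrightarrow> \<alpha> (pair_root w n x y) = pair_root w n (\<pi> x) (\<pi> y)"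
proof -
  obtain \<sigma> s where \<alpha>: "\<alpha> = signed_perm_map n \<sigma> s" and \<sigma>: "\<sigma> permutes {1..n}"
    and s: "\<forall>i\<in>{1..n}. s i = 1 \<or> s i = - 1"
    using assms unfolding weyl_group_BC_def by blast
  \<comment> \<open>The absolute value is forced by
    \<open>coord n (\<pi> x) = \<sigma> (coord n x)\<close>, and the sign of \<open>x\<close> is
    multiplied by that of \<open>s\<close>.\<close>
  define \<pi> where "\<pi> x = (if s (coord n x) = 1 then 1 else - 1) * sgn x * (int n + 1 - int (\<sigma> (coord n x)))" for x
  have \<sigma>_range: "\<sigma> (coord n x) \<in> {1..n}" if "x \<in> positions n" for x
    using permutes_in_image[OF \<sigma>] coord_bounds[OF that] by blast
  have s_cases: "s (coord n x) = 1 \<or> s (coord n x) = - 1" if "x \<in> positions n" for x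
    using s coord_bounds[OF that] by blast
  have \<pi>: "\<pi> x \<in> positions n" "coord n (\<pi> x) = \<sigma> (coord n x)"
      "of_int (sgn (\<pi> x)) = of_int (sgn x) * s (coord n x)" if "x \<in> positions n" for x
  proof -
    have "x > 0 \<or> x < 0" using that by (auto simp: positions_def)
    then show "\<pi> x \<in> positions n" "coord n (\<pi> x) = \<sigma> (coord n x)"
        "of_int (sgn (\<pi> x)) = of_int (sgn x) * s (coord n x)"
      using \<sigma>_range[OF that] s_cases[OF that] by (auto simp: \<pi>_def positions_def coord_def[of n "_ - _"] coord_def[of n "- _ + _"] coord_def[of n "- _"])
  qed
  have odd: "\<pi> (- x) = - \<pi> x" for x by (simp add: \<pi>_def sgn_minus)
  have inj: "inj_on \<pi> (positions n)"
  proof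
    fix x y assume xy: "x \<in> positions n" "y \<in> positions n" "\<pi> x = \<pi> y"
    then have "coord n x = coord n y"
      using \<pi>(2)[of x] \<pi>(2)[of y] permutes_inj[OF \<sigma>] by (simp add: inj_eq)
    moreover have "\<pi> x \<noteq> 0" using \<pi>(1)[OF xy(1)] by (auto simp: positions_def)
    ultimately show "x = y" using coord_eq_iff[OF xy(1,2)] odd[of y] xy(3) by auto
  qed
  have "\<alpha> (pair_root w n x y) = pair_root w n (\<pi> x) (\<pi> y)" if "x \<in> positions n" "y \<in> positions n" for w x y
    unfolding \<alpha> using \<pi> odd inj that
    by (intro signed_perm_map_pair_root signed_perm_map_signed_eps) auto
  then show thesis using that \<pi>(1) inj by blast
qed

text \<open>The permutation and the signs are read off at the positive positions, one for each
  coordinate; oddness determines the rest.\<close>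

lemma position_map_weyl_group_BC:
  assumes pos: "\<And>x. x \<in> positions n \<Longrightarrow> \<pi> x \<in> positions n" and inj: "inj_on \<pi> (positions n)"
    and odd: "\<And>x. x \<in> positions n \<Longrightarrow> \<pi> (- x) = - \<pi> x"
  obtains \<alpha> where "\<alpha> \<in> weyl_group_BC n"
    "\<And>w x y. x \<in> positions n \<Longrightarrow> y \<in> positions n \<Longrightarrow> \<alpha> (pair_root w n x y) = pair_root w n (\<pi> x) (\<pi> y)"
proof -
  define p where "p i = int n + 1 - int i" for i
  have p: "p i \<in> positions n" "coord n (p i) = i" if "i \<in> {1..n}" for i
    using that by (auto simp: p_def positions_def coord_def)
  define \<sigma> where "\<sigma> i = (if i \<in> {1..n} then coord n (\<pi> (p i)) else i)" for i
  define s :: "nat \<Rightarrow> real" where "s i = of_int (sgn (\<pi> (p i)))" for i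
  have \<sigma>_inj: "inj_on \<sigma> {1..n}"
  proof
    fix i j assume ij: "i \<in> {1..n}" "j \<in> {1..n}" "\<sigma> i = \<sigma> j"
    then have "\<pi> (p i) = \<pi> (p j) \<or> \<pi> (p i) = \<pi> (- p j)"
      using coord_eq_iff[of "\<pi> (p i)" n "\<pi> (p j)"] pos p odd by (auto simp: \<sigma>_def)
    then have "p i = p j \<or> p i = - p j"
      using inj p[OF ij(1)] p[OF ij(2)] by (metis inj_onD uminus_positions)
    then show "i = j" using p ij by (metis coord_uminus)
  qed
  have "\<sigma> ` {1..n} \<subseteq> {1..n}"
    using coord_bounds pos p by (auto simp: \<sigma>_def)
  then have "\<sigma> permutes {1..n}"
    using \<sigma>_inj by (intro bij_imp_permutes bij_betw_imageI endo_inj_surj) (auto simp: \<sigma>_def)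
  moreover have "s i = 1 \<or> s i = - 1" if "i \<in> {1..n}" for i
    using pos[OF p(1)[OF that]] by (auto simp: s_def positions_def sgn_if)
  ultimately have "signed_perm_map n \<sigma> s \<in> weyl_group_BC n"
    unfolding weyl_group_BC_def by blast
  moreover have "coord n (\<pi> x) = \<sigma> (coord n x) \<and> real_of_int (sgn (\<pi> x)) = of_int (sgn x) * s (coord n x)"
    if x: "x \<in> positions n" for x
  proof -
    have "p (coord n x) = \<bar>x\<bar>" using x by (auto simp: p_def coord_def positions_def)
    moreover have "x > 0 \<and> \<bar>x\<bar> = x \<or> x < 0 \<and> \<bar>x\<bar> = - x" using x by (auto simp: positions_def)
    ultimately show ?thesis
      using coord_bounds[OF x] odd[OF x] by (auto simp: \<sigma>_def s_def sgn_minus)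
  qed
  ultimately show thesis
    using pos odd inj
    by (intro that[of "signed_perm_map n \<sigma> s"] signed_perm_map_pair_root signed_perm_map_signed_eps) auto
qed

text \<open>A position that \<open>lt\<close> puts above its negative is sent to its rank among all
  such positions, counted from 1, and its negative to minus that rank. At most \<open>n\<close>
  positions are of this kind, as \<open>abs\<close> is injective on them.\<close>

lemma odd_linear_order_embedding:
  fixes lt :: "int \<Rightarrow> int \<Rightarrow> bool"
  assumes irrefl: "\<And>x. \<not> lt x x"
    and trans: "\<And>x y z. x \<in> positions n \<Longrightarrow> y \<in> positions n \<Longrightarrow> z \<in> positions n \<Longrightarrow> lt x y \<Longrightarrow> lt y z \<Longrightarrow> lt x z"
    and total: "\<And>x y. x \<in> positions n \<Longrightarrow> y \<in> positions n \<Longrightarrow> x \<noteq> y \<Longrightarrow> lt x y \<or> lt y x"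
    and odd: "\<And>x y. lt x y \<Longrightarrow> lt (- y) (- x)"
  obtains \<pi> :: "int \<Rightarrow> int" where "\<And>x. x \<in> positions n \<Longrightarrow> \<pi> x \<in> positions n"
    "\<And>x. x \<in> positions n \<Longrightarrow> \<pi> (- x) = - \<pi> x"
    "\<And>x y. x \<in> positions n \<Longrightarrow> y \<in> positions n \<Longrightarrow> lt x y \<Longrightarrow> \<pi> x < \<pi> y"
proof -
  define P where "P = {z \<in> positions n. lt (- z) z}"
  define below where "below x = {z \<in> P. z = x \<or> lt z x}" for x
  define \<pi> where "\<pi> x = (if lt (- x) x then int (card (below x)) else - int (card (below (- x))))" for x
  have finP: "finite P" using finite_positions unfolding P_def by auto
  have pos_neg: "lt (- x) x \<longleftrightarrow> \<not> lt x (- x)" if "x \<in> positions n" for x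
  proof -
    have "x \<noteq> - x" "- x \<in> positions n" using that by (auto simp: positions_def)
    then show ?thesis using total[OF that, of "- x"] trans[OF that _ that, of "- x"] irrefl by blast
  qed
  have "card P \<le> card {1..int n}"
  proof (rule card_inj_on_le[of abs])
    show "inj_on abs P"
    proof
      fix x y assume "x \<in> P" "y \<in> P" "\<bar>x\<bar> = \<bar>y\<bar>"
      then show "x = y" using pos_neg[of y] by (auto simp: P_def abs_eq_iff)
    qed
  qed (auto simp: P_def positions_def)
  then have card_below: "card (below x) \<le> n" for x
    using card_mono[OF finP, of "below x"] by (auto simp: below_def)
  have card_pos: "0 < card (below x)" if "x \<in> P" for x
    using that finP by (auto simp: below_def card_gt_0_iff)
  have below_less: "card (below x) < card (below y)" if "x \<in> P" "y \<in> P" "lt x y" for x y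
  proof (rule psubset_card_mono)
    show "finite (below y)" using finP by (auto simp: below_def)
    have "y \<notin> below x" using that trans[of y x y] irrefl by (auto simp: below_def P_def)
    moreover have "y \<in> below y" using that by (auto simp: below_def)
    moreover have "below x \<subseteq> below y" using that trans[of _ x y] by (auto simp: below_def P_def)
    ultimately show "below x \<subset> below y" by blast
  qed
  have split: "x \<in> P \<or> - x \<in> P" if "x \<in> positions n" for x
    using that pos_neg[OF that] by (auto simp: P_def)
  have \<pi>_P: "\<pi> x = int (card (below x))" if "x \<in> P" for x
    using that by (auto simp: \<pi>_def P_def)
  have \<pi>_odd: "\<pi> (- x) = - \<pi> x" if "x \<in> positions n" for x
    using pos_neg[OF that] by (auto simp: \<pi>_def)
  have \<pi>_neg: "\<pi> x = - int (card (below (- x)))" if "- x \<in> P" for x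
    using \<pi>_P[OF that] \<pi>_odd[of x] that by (auto simp: P_def)
  show thesis
  proof (rule that[of \<pi>])
    show "\<pi> x \<in> positions n" if "x \<in> positions n" for x
      using split[OF that] \<pi>_P[of x] \<pi>_neg[of x] card_pos card_below[of x] card_below[of "- x"]
      by (force simp: positions_def)
    show "\<pi> x < \<pi> y" if xy: "x \<in> positions n" "y \<in> positions n" "lt x y" for x y
    proof -
      consider "x \<in> P" "y \<in> P" | "- x \<in> P" "- y \<in> P" | "- x \<in> P" "y \<in> P" | "x \<in> P" "- y \<in> P"
        using split xy by blast
      then show ?thesis
      proof cases
        \<comment> \<open>Impossible: in the order \<open>lt\<close>, \<open>- x\<close> precedes
          \<open>x\<close>, then \<open>y\<close>, then \<open>- y\<close>; negating the resulting
          \<open>lt (- x) (- y)\<close> gives \<open>lt y x\<close>.\<close>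
        case 4
        then have "lt (- x) x" "lt y (- y)" by (auto simp: P_def)
        then have "lt (- x) (- y)"
          using trans[of "- x" x y] trans[of "- x" y "- y"] xy by auto
        then have "lt y x" using odd[of "- x" "- y"] by simp
        then show ?thesis using trans[of x y x] xy irrefl by blast
      qed (use \<pi>_P \<pi>_neg below_less[of x y] below_less[of "- y" "- x"] odd[OF xy(3)] xy(3)
          card_pos[of "- x"] card_pos[of y] in auto)
    qed
  qed (rule \<pi>_odd)
qed

text \<open>A Weyl group element inverts the pairs whose order its map of positions reverses, and
  transitivity of the order gives both conditions. Conversely, reversing the pairs in
  \<open>I\<close> gives a relation that is transitive because \<open>I\<close> is biclosed and odd
  because mirror pairs share a root; its embedding into the positions is the element sought.\<close>

lemma inversion_set_roots_iff:
  assumes w: "0 < w" and I: "I \<subseteq> roots w n"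
  shows "(\<exists>\<alpha>\<in>weyl_group_BC n. I = inversion_set (roots w n) \<alpha>) \<longleftrightarrow>
    (\<forall>x y z. pair_C (int n) x y \<and> pair_C (int n) y z \<longrightarrow>
      (pair_root w n x y \<in> I \<and> pair_root w n y z \<in> I \<longrightarrow> pair_root w n x z \<in> I) \<and>
      (pair_root w n x z \<in> I \<longrightarrow> pair_root w n x y \<in> I \<or> pair_root w n y z \<in> I))"
    (is "?L \<longleftrightarrow> ?R")
proof
  assume ?L
  then obtain \<alpha> where \<alpha>: "\<alpha> \<in> weyl_group_BC n" and I_eq: "I = inversion_set (roots w n) \<alpha>" by blast
  obtain \<pi> where pos: "\<And>x. x \<in> positions n \<Longrightarrow> \<pi> x \<in> positions n" and inj: "inj_on \<pi> (positions n)"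
    and \<pi>: "\<And>w x y. x \<in> positions n \<Longrightarrow> y \<in> positions n \<Longrightarrow> \<alpha> (pair_root w n x y) = pair_root w n (\<pi> x) (\<pi> y)"
    using weyl_group_BC_position_map[OF \<alpha>] by blast
  have "pair_root w n x y \<in> I \<longleftrightarrow> \<pi> y < \<pi> x" if "pair_C (int n) x y" for x y
  proof -
    have xy: "x \<in> positions n" "y \<in> positions n" "x < y" using that by (auto simp: pair_C_iff)
    then have "\<pi> x \<noteq> \<pi> y" using inj by (auto dest: inj_onD)
    then show ?thesis
      using xy pos \<pi>[OF xy(1,2), of w] pair_root_in_roots_iff[OF w, of "\<pi> x" n "\<pi> y"]
        pair_root_in_roots_iff[OF w, of x n y]
      by (auto simp: I_eq inversion_set_def)
  qed
  moreover have "pair_C (int n) x z" if "pair_C (int n) x y" "pair_C (int n) y z" for x y z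
    using that by (auto simp: pair_C_def)
  ultimately show ?R by force
next
  assume R: ?R
  define lt where "lt x y \<longleftrightarrow> x < y \<and> pair_root w n x y \<notin> I \<or> y < x \<and> pair_root w n y x \<in> I" for x y
  obtain \<pi> where pos: "\<And>x. x \<in> positions n \<Longrightarrow> \<pi> x \<in> positions n"
    and odd: "\<And>x. x \<in> positions n \<Longrightarrow> \<pi> (- x) = - \<pi> x"
    and mono: "\<And>x y. x \<in> positions n \<Longrightarrow> y \<in> positions n \<Longrightarrow> lt x y \<Longrightarrow> \<pi> x < \<pi> y"
  proof (rule odd_linear_order_embedding[of lt n])
    show "\<not> lt x x" for x by (simp add: lt_def)
    show "lt x y \<or> lt y x" if "x \<noteq> y" for x y using that by (auto simp: lt_def)
    show "lt (- y) (- x)" if "lt x y" for x y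
      using that pair_root_uminus[of w n x y] pair_root_uminus[of w n y x] by (auto simp: lt_def)
    show "lt x z" if p: "x \<in> positions n" "y \<in> positions n" "z \<in> positions n" and l: "lt x y" "lt y z" for x y z
    proof -
      have R': "(pair_root w n a b \<in> I \<and> pair_root w n b c \<in> I \<longrightarrow> pair_root w n a c \<in> I) \<and>
          (pair_root w n a c \<in> I \<longrightarrow> pair_root w n a b \<in> I \<or> pair_root w n b c \<in> I)"
        if "{a, b, c} \<subseteq> {x, y, z}" "a < b" "b < c" for a b c
      proof -
        have "pair_C (int n) a b" "pair_C (int n) b c" using that p by (auto simp: pair_C_iff)
        then show ?thesis using R by blast
      qed
      have "x \<noteq> y" "y \<noteq> z" using l by (auto simp: lt_def)
      \<comment> \<open>For each relative order one of the two conditions on the sorted triple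
        yields transitivity; \<open>x = z\<close> is excluded, since \<open>lt x y\<close> and
        \<open>lt y x\<close> are incompatible.\<close>
      then consider "x < y" "y < z" | "x < z" "z < y" | "y < x" "x < z" | "y < z" "z < x"
        | "z < x" "x < y" | "z < y" "y < x" | "x = z" by linarith
      then show ?thesis
      proof cases
        case 1 then show ?thesis using l R'[of x y z] by (auto simp: lt_def)
      next
        case 2 then show ?thesis using l R'[of x z y] by (auto simp: lt_def)
      next
        case 3 then show ?thesis using l R'[of y x z] by (auto simp: lt_def)
      next
        case 4 then show ?thesis using l R'[of y z x] by (auto simp: lt_def)
      next
        case 5 then show ?thesis using l R'[of z x y] by (auto simp: lt_def)
      next
        case 6 then show ?thesis using l R'[of z y x] by (auto simp: lt_def)
      next
        case 7 then show ?thesis using l by (auto simp: lt_def)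
      qed
    qed
  qed auto
  have inj: "inj_on \<pi> (positions n)"
  proof
    fix x y assume "x \<in> positions n" "y \<in> positions n" "\<pi> x = \<pi> y"
    then show "x = y" using mono[of x y] mono[of y x] unfolding lt_def
      by (cases x y rule: linorder_cases) auto
  qed
  obtain \<alpha> where \<alpha>: "\<alpha> \<in> weyl_group_BC n"
    "\<And>w x y. x \<in> positions n \<Longrightarrow> y \<in> positions n \<Longrightarrow> \<alpha> (pair_root w n x y) = pair_root w n (\<pi> x) (\<pi> y)"
    using position_map_weyl_group_BC[OF pos inj odd] by blast
  have key: "pair_root w n x y \<in> I \<longleftrightarrow> \<alpha> (pair_root w n x y) \<notin> roots w n" if "pair_C (int n) x y" for x y
  proof -
    have xy: "x \<in> positions n" "y \<in> positions n" "x < y" using that by (auto simp: pair_C_iff)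
    then have "\<pi> x \<noteq> \<pi> y" using inj by (auto dest: inj_onD)
    moreover have "pair_root w n x y \<in> I \<longleftrightarrow> \<pi> y < \<pi> x"
      using mono[of x y] mono[of y x] xy unfolding lt_def by fastforce
    ultimately show ?thesis
      using xy pos \<alpha>(2)[OF xy(1,2), of w] pair_root_in_roots_iff[OF w, of "\<pi> x" n "\<pi> y"] by auto
  qed
  have "I = inversion_set (roots w n) \<alpha>"
    unfolding inversion_set_def
  proof (intro set_eqI iffI)
    fix v assume "v \<in> I"
    then obtain x y where "v = pair_root w n x y" "pair_C (int n) x y" using I unfolding roots_def by blast
    then show "v \<in> {v \<in> roots w n. \<alpha> v \<notin> roots w n}" using key \<open>v \<in> I\<close> I by blast
  next
    fix v assume v: "v \<in> {v \<in> roots w n. \<alpha> v \<notin> roots w n}"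
    then obtain x y where "v = pair_root w n x y" "pair_C (int n) x y" unfolding roots_def by blast
    then show "v \<in> I" using key v by blast
  qed
  then show ?L using \<alpha>(1) by blast
qed

section \<open>Decompositions as colourings\<close>

definition color_class :: "real \<Rightarrow> nat \<Rightarrow> (int \<Rightarrow> int \<Rightarrow> int) \<Rightarrow> int \<Rightarrow> (nat \<Rightarrow> real) set" where
  "color_class w n f c = {pair_root w n x y | x y. pair_C (int n) x y \<and> f x y = c}"

definition color_partition :: "real \<Rightarrow> nat \<Rightarrow> (int \<Rightarrow> int \<Rightarrow> int) \<Rightarrow> (nat \<Rightarrow> real) set set" where
  "color_partition w n f = color_class w n f ` {0..<int n}"

lemma pair_root_eq_pair_rootD:
  assumes "0 < w" "pair_C (int n) x y" "pair_C (int n) x' y'" "pair_root w n x y = pair_root w n x' y'"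
  shows "x' = x \<and> y' = y \<or> x' = - y \<and> y' = - x"
  using assms pair_root_eq_iff[of w x n y x' y'] by (auto simp: pair_C_iff)

lemma pair_root_in_color_class_iff:
  assumes w: "0 < w" and f: "f \<in> colorings_C (int n)" and xy: "pair_C (int n) x y"
  shows "pair_root w n x y \<in> color_class w n f c \<longleftrightarrow> f x y = c"
proof
  assume "pair_root w n x y \<in> color_class w n f c"
  then obtain x' y' where "pair_root w n x y = pair_root w n x' y'" "pair_C (int n) x' y'" "f x' y' = c"
    unfolding color_class_def by blast
  then show "f x y = c"
    using pair_root_eq_pair_rootD[OF w xy, of x' y'] colorings_C_sym[OF f, of y x] by auto
qed (use xy in \<open>auto simp: color_class_def\<close>)

lemma simple_root_eq_pair_root:
  assumes "0 \<le> c" "c < int n"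
  obtains x y where "pair_C (int n) x y" "simple_root w n c = pair_root w n x y"
    "\<And>f. f \<in> colorings_C (int n) \<Longrightarrow> f x y = c"
proof (cases "c = 0")
  case True
  show thesis
    by (rule that[of "- 1" 1])
      (use assms True colorings_C_central_edge in \<open>auto simp: pair_C_def simple_root_def\<close>)
next
  case False
  show thesis
    by (rule that[of c "c + 1"])
      (use assms False colorings_C_edge in \<open>auto simp: pair_C_def simple_root_def\<close>)
qed

lemma simple_root_in_color_class_iff:
  assumes "0 < w" "f \<in> colorings_C (int n)" "0 \<le> c" "c < int n"
  shows "simple_root w n c \<in> color_class w n f c' \<longleftrightarrow> c = c'"
  using simple_root_eq_pair_root[OF assms(3,4), of w] pair_root_in_color_class_iff[OF assms(1,2)] assms(2)
  by metis

text \<open>The triangle condition makes every colour class biclosed, hence an inversion set, and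
  the prescribed edge colours put exactly one simple root into each class.\<close>

lemma color_partition_in_decompositions:
  assumes w: "0 < w" and f: "f \<in> colorings_C (int n)"
  shows "color_partition w n f \<in>
    decompositions (weyl_group_BC n) (roots w n) (simple_root w n ` {0..<int n})"
proof -
  have sub: "color_class w n f c \<subseteq> roots w n" for c
    unfolding color_class_def roots_def by blast
  have "\<Union> (color_partition w n f) = roots w n"
  proof
    show "\<Union> (color_partition w n f) \<subseteq> roots w n" using sub by (auto simp: color_partition_def)
    show "roots w n \<subseteq> \<Union> (color_partition w n f)"
    proof
      fix v assume "v \<in> roots w n"
      then obtain x y where v: "v = pair_root w n x y" "pair_C (int n) x y" unfolding roots_def by blast
      then have "v \<in> color_class w n f (f x y)" by (auto simp: color_class_def)
      then show "v \<in> \<Union> (color_partition w n f)"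
        using colorings_C_range[OF f v(2)] unfolding color_partition_def by auto
    qed
  qed
  moreover have "c = c'" if v_in: "v \<in> color_class w n f c" "v \<in> color_class w n f c'" for v c c'
  proof -
    obtain x y where v: "v = pair_root w n x y" "pair_C (int n) x y"
      using v_in(1) unfolding color_class_def by blast
    then show ?thesis using v_in pair_root_in_color_class_iff[OF w f v(2)] by auto
  qed
  then have "disjoint (color_partition w n f)"
    unfolding color_partition_def by (intro disjointI) blast
  moreover have simple: "simple_root w n c \<in> color_class w n f c' \<longleftrightarrow> c = c'" if "c \<in> {0..<int n}" for c c'
    using simple_root_in_color_class_iff[OF w f] that by auto
  then have "{} \<notin> color_partition w n f"
    unfolding color_partition_def by blast
  ultimately have "partition_on (roots w n) (color_partition w n f)"
    unfolding partition_on_def by blast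
  moreover have "(\<exists>\<alpha>\<in>weyl_group_BC n. color_class w n f c = inversion_set (roots w n) \<alpha>)" for c
  proof -
    show ?thesis
      unfolding inversion_set_roots_iff[OF w sub]
    proof (intro allI impI)
      fix x y z assume xyz: "pair_C (int n) x y \<and> pair_C (int n) y z"
      then have xy: "pair_C (int n) x y" and yz: "pair_C (int n) y z" and xz: "pair_C (int n) x z"
        by (auto simp: pair_C_def)
      have "f x z = f x y \<or> f x z = f y z"
        using colorings_C_tri[OF f, of x y z] xyz by (auto simp: pair_C_def)
      then show "(pair_root w n x y \<in> color_class w n f c \<and> pair_root w n y z \<in> color_class w n f c \<longrightarrow>
            pair_root w n x z \<in> color_class w n f c) \<and>
          (pair_root w n x z \<in> color_class w n f c \<longrightarrow>
            pair_root w n x y \<in> color_class w n f c \<or> pair_root w n y z \<in> color_class w n f c)"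
        unfolding pair_root_in_color_class_iff[OF w f xy] pair_root_in_color_class_iff[OF w f yz]
          pair_root_in_color_class_iff[OF w f xz] by auto
    qed
  qed
  moreover have "\<exists>!r. r \<in> simple_root w n ` {0..<int n} \<and> r \<in> color_class w n f c"
    if c: "c \<in> {0..<int n}" for c
  proof (rule ex1I[of _ "simple_root w n c"])
    show "simple_root w n c \<in> simple_root w n ` {0..<int n} \<and> simple_root w n c \<in> color_class w n f c"
      using simple[OF c, of c] c by simp
    show "r = simple_root w n c"
      if "r \<in> simple_root w n ` {0..<int n} \<and> r \<in> color_class w n f c" for r
      using that simple by auto
  qed
  ultimately show ?thesis
    unfolding decompositions_def color_partition_def by simp
qed

text \<open>A class reveals its colour through the simple root it contains, so the partition
  determines the colour of every pair.\<close>

lemma inj_on_color_partition: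
  assumes w: "0 < w"
  shows "inj_on (color_partition w n) (colorings_C (int n))"
proof
  fix f g assume f: "f \<in> colorings_C (int n)" and g: "g \<in> colorings_C (int n)"
    and eq: "color_partition w n f = color_partition w n g"
  show "f = g"
  proof (intro ext)
    fix x y
    show "f x y = g x y"
    proof (cases "pair_C (int n) x y")
      case True
      define c where "c = f x y"
      have c: "0 \<le> c" "c < int n" using colorings_C_range[OF f True] by (auto simp: c_def)
      then obtain c' where c': "color_class w n f c = color_class w n g c'"
        using eq unfolding color_partition_def by (metis (no_types, lifting) atLeastLessThan_iff image_iff)
      then have "c = c'"
        using simple_root_in_color_class_iff[OF w f c, of c] simple_root_in_color_class_iff[OF w g c, of c'] by auto
      then show ?thesis
        using pair_root_in_color_class_iff[OF w f True, of c] pair_root_in_color_class_iff[OF w g True, of c] c'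
        by (auto simp: c_def)
    next
      case False
      then show ?thesis using colorings_C_outside f g by metis
    qed
  qed
qed

lemma inj_on_simple_root:
  assumes w: "0 < w"
  shows "inj_on (simple_root w n) {0..<int n}"
proof
  fix c c' assume c: "c \<in> {0..<int n}" "c' \<in> {0..<int n}" "simple_root w n c = simple_root w n c'"
  have pair: "pair_C (int n) (if a = 0 then - 1 else a) (if a = 0 then 1 else a + 1)"
      "simple_root w n a = pair_root w n (if a = 0 then - 1 else a) (if a = 0 then 1 else a + 1)"
    if "a \<in> {0..<int n}" for a
    using that by (auto simp: pair_C_def simple_root_def)
  show "c = c'"
    using pair_root_eq_pair_rootD[OF w pair(1)[OF c(1)] pair(1)[OF c(2)]
        c(3)[unfolded pair(2)[OF c(1)] pair(2)[OF c(2)]]] c(1,2)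
    by (cases "c = 0"; cases "c' = 0") auto
qed

text \<open>Colour each pair by the index of the simple root in the part containing its root.
  Biclosedness puts the root of \<open>(x, y)\<close> or of \<open>(y, z)\<close> into the part of
  \<open>(x, z)\<close>, which is the triangle condition.\<close>

lemma decompositions_subset_color_partition:
  assumes w: "0 < w"
    and D: "D \<in> decompositions (weyl_group_BC n) (roots w n) (simple_root w n ` {0..<int n})"
  shows "D \<in> color_partition w n ` colorings_C (int n)"
proof -
  have part: "partition_on (roots w n) D"
    and inv: "\<And>I. I \<in> D \<Longrightarrow> \<exists>\<alpha>\<in>weyl_group_BC n. I = inversion_set (roots w n) \<alpha>"
    and ex1: "\<And>I. I \<in> D \<Longrightarrow> \<exists>!r. r \<in> simple_root w n ` {0..<int n} \<and> r \<in> I"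
    using D unfolding decompositions_def by auto
  have same: "I = J" if "I \<in> D" "J \<in> D" "v \<in> I" "v \<in> J" for I J v
    using that partition_onD2[OF part] by (auto dest: disjointD)
  have cover: "\<exists>I\<in>D. v \<in> I" if "v \<in> roots w n" for v
    using that partition_onD1[OF part] by blast
  have sub: "I \<subseteq> roots w n" if "I \<in> D" for I
    using that partition_onD1[OF part] by blast
  define f where "f x y = (if pair_C (int n) x y then
      THE c. c \<in> {0..<int n} \<and> (\<exists>I\<in>D. pair_root w n x y \<in> I \<and> simple_root w n c \<in> I) else 0)" for x y
  have f: "f x y = c" if "pair_C (int n) x y" "I \<in> D" "pair_root w n x y \<in> I"
      "c \<in> {0..<int n}" "simple_root w n c \<in> I" for x y c I
  proof -
    \<comment> \<open>Disjointness determines the part, the single simple root in it and injectivity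
      of \<open>simple_root\<close> determine the index.\<close>
    have "(THE c. c \<in> {0..<int n} \<and> (\<exists>I\<in>D. pair_root w n x y \<in> I \<and> simple_root w n c \<in> I)) = c"
    proof (rule the_equality)
      fix c' assume c': "c' \<in> {0..<int n} \<and> (\<exists>I\<in>D. pair_root w n x y \<in> I \<and> simple_root w n c' \<in> I)"
      then have "simple_root w n c' \<in> I" using same that by blast
      then have "simple_root w n c' = simple_root w n c" using ex1[OF \<open>I \<in> D\<close>] c' that by blast
      then show "c' = c" using inj_on_simple_root[OF w, of n] c' that by (auto dest: inj_onD)
    qed (use that in blast)
    then show ?thesis using that by (simp add: f_def)
  qed
  have part_of: "\<exists>I\<in>D. pair_root w n x y \<in> I \<and> f x y \<in> {0..<int n} \<and> simple_root w n (f x y) \<in> I"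
    if xy: "pair_C (int n) x y" for x y
  proof -
    obtain I where I: "I \<in> D" "pair_root w n x y \<in> I" using cover xy unfolding roots_def by blast
    then obtain c where "c \<in> {0..<int n}" "simple_root w n c \<in> I" using ex1 by blast
    then show ?thesis using f[OF xy I] I by blast
  qed
  have f_col: "f \<in> colorings_C (int n)"
    unfolding colorings_C_def
  proof (intro CollectI conjI allI impI)
    show "f x y = 0" if "\<not> pair_C (int n) x y" for x y using that by (simp add: f_def)
    have "pair_C (int n) (- y) (- x) \<longleftrightarrow> pair_C (int n) x y" for x y by (auto simp: pair_C_def)
    then show "f (- y) (- x) = f x y" for x y unfolding f_def pair_root_uminus by simp
    show "f (- 1) 1 = 0" if "0 < int n"
    proof -
      have xy: "pair_C (int n) (- 1) 1" using that by (simp add: pair_C_def)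
      obtain I where I: "I \<in> D" "pair_root w n (- 1) 1 \<in> I" using part_of[OF xy] by blast
      then show ?thesis using f[OF xy I, of 0] that by (simp add: simple_root_def)
    qed
    show "f k (k + 1) = k" if "1 \<le> k \<and> k < int n" for k
    proof -
      have xy: "pair_C (int n) k (k + 1)" using that by (simp add: pair_C_def)
      obtain I where I: "I \<in> D" "pair_root w n k (k + 1) \<in> I" using part_of[OF xy] by blast
      then show ?thesis using f[OF xy I, of k] that by (simp add: simple_root_def)
    qed
    show "f x z = f x y \<or> f x z = f y z" if p: "pair_C (int n) x y \<and> pair_C (int n) y z" for x y z
    proof -
      have xz: "pair_C (int n) x z" using p by (auto simp: pair_C_def)
      obtain I where I: "I \<in> D" "pair_root w n x z \<in> I" "f x z \<in> {0..<int n}" "simple_root w n (f x z) \<in> I"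
        using part_of[OF xz] by blast
      then have "pair_root w n x y \<in> I \<or> pair_root w n y z \<in> I"
        using inv[OF I(1)] p unfolding inversion_set_roots_iff[OF w sub[OF I(1)]] by blast
      then show ?thesis using f[OF _ I(1) _ I(3,4)] p by metis
    qed
  qed
  have class_eq: "I = color_class w n f c" if I: "I \<in> D" "c \<in> {0..<int n}" "simple_root w n c \<in> I" for I c
  proof (intro set_eqI iffI)
    fix v assume v: "v \<in> I"
    then obtain x y where xy: "v = pair_root w n x y" "pair_C (int n) x y" using sub[OF I(1)] unfolding roots_def by blast
    then have "f x y = c" using f[OF xy(2) I(1) _ I(2,3)] v by simp
    then show "v \<in> color_class w n f c" using xy by (auto simp: color_class_def)
  next
    fix v assume "v \<in> color_class w n f c"
    then obtain x y where xy: "v = pair_root w n x y" "pair_C (int n) x y" "f x y = c" unfolding color_class_def by blast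
    then obtain J where "J \<in> D" "v \<in> J" "simple_root w n c \<in> J" using part_of[OF xy(2)] by auto
    then show "v \<in> I" using same I by blast
  qed
  have "D = color_partition w n f"
    unfolding color_partition_def
  proof (intro set_eqI iffI)
    fix I assume "I \<in> D"
    then show "I \<in> color_class w n f ` {0..<int n}" using ex1 class_eq by blast
  next
    fix I assume "I \<in> color_class w n f ` {0..<int n}"
    then obtain c where c: "c \<in> {0..<int n}" "I = color_class w n f c" by blast
    then have "simple_root w n c \<in> roots w n"
      using simple_root_eq_pair_root[of c n w] unfolding roots_def by fastforce
    then obtain J where "J \<in> D" "simple_root w n c \<in> J" using cover by blast
    then show "I \<in> D" using class_eq c by blast
  qed
  then show ?thesis using f_col by blast
qed

lemma card_decompositions_roots:
  assumes "0 < w"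
  shows "card (decompositions (weyl_group_BC n) (roots w n) (simple_root w n ` {0..<int n})) =
    card (colorings_C (int n))"
proof -
  have "color_partition w n ` colorings_C (int n) =
      decompositions (weyl_group_BC n) (roots w n) (simple_root w n ` {0..<int n})"
    using color_partition_in_decompositions[OF assms] decompositions_subset_color_partition[OF assms] by blast
  then show ?thesis using card_image[OF inj_on_color_partition[OF assms, of n]] by simp
qed

lemma card_decompositions_B: "1 \<le> n \<Longrightarrow> card (decompositions_B n) = card (colorings_C (int n))"
  unfolding decompositions_B_def pos_roots_B_eq by (simp add: simple_roots_B_eq card_decompositions_roots)

lemma card_decompositions_C: "1 \<le> n \<Longrightarrow> card (decompositions_C n) = card (colorings_C (int n))"
  unfolding decompositions_C_def pos_roots_C_eq by (simp add: simple_roots_C_eq card_decompositions_roots)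

text \<open>The convention \<open>cat_B 0 = 1\<close> agrees with the one colouring of no pairs, so
  the recurrence for colourings transfers uniformly.\<close>

lemma cat_B_eq: "cat_B n = card (colorings_C (int n))"
  by (cases "n = 0") (simp_all add: cat_B_def card_decompositions_B colorings_C_zero)

theorem proposition6p2:
  shows "(\<forall>n\<ge>1. card (decompositions_C n) = cat_B n)
    \<and> (\<forall>n\<ge>1. real (cat_B n) =
           real (cat_B (n - 1)) + 2 * (\<Sum>k\<in>{0..<n - 1}. cat_A (n - k - 1) * real (cat_B k)))
    \<and> Abs_fps (\<lambda>n. real (cat_B n)) =
           1 / (fps_radical root 2 (1 - 4 * fps_X) + fps_X)"
proof (intro conjI allI impI)
  show "card (decompositions_C n) = cat_B n" if "n \<ge> 1" for n
    using card_decompositions_C[OF that] by (simp add: cat_B_eq)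
  have rec: "real (cat_B n) = real (cat_B (n - 1))
      + 2 * (\<Sum>k\<in>{0..<n - 1}. cat_A (n - k - 1) * real (cat_B k))" if "n \<ge> 1" for n
    using card_colorings_C[OF that] by (simp only: cat_B_eq)
  then show "real (cat_B n) = real (cat_B (n - 1))
      + 2 * (\<Sum>k\<in>{0..<n - 1}. cat_A (n - k - 1) * real (cat_B k))" if "n \<ge> 1" for n
    using that by blast
  show "Abs_fps (\<lambda>n. real (cat_B n)) = 1 / (fps_radical root 2 (1 - 4 * fps_X) + fps_X)"
    using rec by (intro fps_of_recurrence) (auto simp: cat_B_def)
qed

end
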